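(* Let $G$ be a finite simple connected graph of order $n$ with minimum degree $\delta$ and essential connectivity $\kappa'$, where $n\geq \kappa'+4$. Then $$\rho(G)\leq \rho(G_n^{\kappa',\delta}),$$ with equality if and only if $G\cong G_n^{\kappa',\delta}$.
   Context: For a graph $G$, $\rho(G)$ denotes its spectral radius, i.e. the largest eigenvalue of its adjacency matrix. A graph is trivial if it consists of one vertex and no edges; otherwise it is non-trivial. A set $S\subseteq V(G)$ is an essential vertex cut of $G$ if $G-S$ has at least two non-trivial connected components ($G-S$ may additionally have trivial components). The essential connectivity $\kappa'=\kappa'(G)$ is the minimum cardinality of an essential vertex cut of $G$ (so the statement concerns graphs that have an essential vertex cut). $K_m$ is the complete graph on $m$ vertices, $G_1\cup G_2$ is the disjoint union of graphs, and the join $G_1\vee G_2$ is obtained from the disjoint union $G_1\cup G_2$ by adding all edges between $V(G_1)$ and $V(G_2)$. The graph $G_n^{\kappa',\delta}$ is defined as follows. (i) If $\kappa'>\delta-1$: take an isolated vertex $u$ together with the disjoint graph $K_{\kappa'}\vee(K_1\cup K_{n-\kappa'-2})$; join $u$ by $\delta-1$ edges to $\delta-1$ distinct vertices of $K_{\kappa'}$, and join $u$ by one edge to the vertex of $K_1$. The result is $G_n^{\kappa',\delta}$ (well defined up to isomorphism). (ii) If $\kappa'\leq \delta-1$: $G_n^{\kappa',\delta}=K_{\kappa'}\vee(K_{n-\delta-1}\cup K_{\delta-\kappa'+1})$. *)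

theory Defs
  imports
    "Graph_Theory.Graph_Theory"
    "Jordan_Normal_Form.Char_Poly"
begin

text \<open>
  A finite simple graph is a \<^locale>\<open>pair_graph\<close>: a symmetric, loop-free relation on a finite
  vertex set, so that every edge is represented by its two orientations. On such graphs
  \<^const>\<open>out_degree\<close> is the usual degree, and the elements of \<^const>\<open>pre_digraph.sccs\<close> are the
  connected components, as (induced) subgraphs.
\<close>

section \<open>Spectral radius\<close>

definition adjacency_matrix :: "'a pair_pre_digraph \<Rightarrow> 'a list \<Rightarrow> real mat" where
  "adjacency_matrix G vs =
     mat (length vs) (length vs) (\<lambda>(i, j). if (vs ! i, vs ! j) \<in> parcs G then 1 else 0)"

text \<open>The enumeration of the vertices does not matter, see \<open>eigenvalue_adjacency_matrix\<close> below.\<close>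

definition graph_spectral_radius :: "'a pair_pre_digraph \<Rightarrow> real" where
  "graph_spectral_radius G =
     Max {k. eigenvalue (adjacency_matrix G (SOME vs. distinct vs \<and> set vs = pverts G)) k}"

lemma eigenvalue_adjacency_matrix:
  assumes "distinct vs"
  shows "eigenvalue (adjacency_matrix G vs) k \<longleftrightarrow>
    (\<exists>f. (\<exists>v\<in>set vs. f v \<noteq> 0) \<and>
         (\<forall>v\<in>set vs. (\<Sum>w\<in>{w\<in>set vs. (v, w) \<in> parcs G}. f w) = k * f v))"
    (is "?L \<longleftrightarrow> ?R")
proof -
  let ?n = "length vs" and ?A = "adjacency_matrix G vs"
  have row: "(?A *\<^sub>v x) $ i = (\<Sum>w\<in>{w\<in>set vs. (vs ! i, w) \<in> parcs G}. f w)"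
    if i: "i < ?n" and x: "x \<in> carrier_vec ?n" and xf: "\<And>j. j < ?n \<Longrightarrow> x $ j = f (vs ! j)"
    for x i f
  proof -
    have "(?A *\<^sub>v x) $ i = (\<Sum>j<?n. (if (vs ! i, vs ! j) \<in> parcs G then f (vs ! j) else 0))"
      using i x xf
      by (auto simp: adjacency_matrix_def scalar_prod_def lessThan_atLeast0 intro!: sum.cong)
    also have "\<dots> = (\<Sum>w\<in>set vs. (if (vs ! i, w) \<in> parcs G then f w else 0))"
      by (rule sum.reindex_bij_betw[OF bij_betw_nth[OF assms refl refl]])
    also have "\<dots> = (\<Sum>w\<in>{w\<in>set vs. (vs ! i, w) \<in> parcs G}. f w)"
      by (simp add: sum.If_cases Int_def)
    finally show ?thesis .
  qed
  show ?thesis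
  proof
    assume ?L
    then obtain x where x: "x \<in> carrier_vec ?n" "x \<noteq> 0\<^sub>v ?n" "?A *\<^sub>v x = k \<cdot>\<^sub>v x"
      by (auto simp: eigenvalue_def eigenvector_def adjacency_matrix_def)
    define f where "f v = x $ the_inv_into {..<?n} ((!) vs) v" for v
    have inj: "inj_on ((!) vs) {..<?n}"
      using assms by (simp add: inj_on_nth)
    have xf: "x $ j = f (vs ! j)" if "j < ?n" for j
      using that by (simp add: f_def the_inv_into_f_f[OF inj])
    have "\<exists>i<?n. x $ i \<noteq> 0"
    proof (rule ccontr)
      assume "\<not> (\<exists>i<?n. x $ i \<noteq> 0)"
      then have "x = 0\<^sub>v ?n"
        using x(1) by (intro eq_vecI) auto
      then show False using x(2) by simp
    qed
    then obtain i where i: "i < ?n" "x $ i \<noteq> 0" by blast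
    have "(\<Sum>w\<in>{w\<in>set vs. (v, w) \<in> parcs G}. f w) = k * f v" if v: "v \<in> set vs" for v
    proof -
      obtain j where j: "j < ?n" "v = vs ! j"
        using v by (auto simp: in_set_conv_nth)
      have "(?A *\<^sub>v x) $ j = k * x $ j"
        using x(1,3) j(1) by simp
      then show ?thesis
        using row[OF j(1) x(1) xf] j xf by simp
    qed
    moreover have "f (vs ! i) \<noteq> 0" "vs ! i \<in> set vs"
      using i xf by auto
    ultimately show ?R by blast
  next
    assume ?R
    then obtain f v where f: "v \<in> set vs" "f v \<noteq> 0"
      "\<And>v. v \<in> set vs \<Longrightarrow> (\<Sum>w\<in>{w\<in>set vs. (v, w) \<in> parcs G}. f w) = k * f v"
      by blast
    define x where "x = vec ?n (\<lambda>i. f (vs ! i))"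
    obtain i where i: "i < ?n" "v = vs ! i"
      using f(1) by (auto simp: in_set_conv_nth)
    have x: "x \<in> carrier_vec ?n" "\<And>j. j < ?n \<Longrightarrow> x $ j = f (vs ! j)"
      by (auto simp: x_def)
    have "x \<noteq> 0\<^sub>v ?n"
    proof
      assume "x = 0\<^sub>v ?n"
      then have "x $ i = 0" using i(1) by simp
      then show False using f(2) i x(2) by simp
    qed
    moreover have "?A *\<^sub>v x = k \<cdot>\<^sub>v x"
    proof (rule eq_vecI)
      show "dim_vec (?A *\<^sub>v x) = dim_vec (k \<cdot>\<^sub>v x)"
        by (simp add: adjacency_matrix_def x_def)
      fix j assume "j < dim_vec (k \<cdot>\<^sub>v x)"
      then have j: "j < ?n" by (simp add: x_def)
      show "(?A *\<^sub>v x) $ j = (k \<cdot>\<^sub>v x) $ j"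
        using row[OF j x] f(3)[of "vs ! j"] j x by simp
    qed
    ultimately show ?L
      using x(1) by (auto simp: eigenvalue_def eigenvector_def adjacency_matrix_def)
  qed
qed


section \<open>Minimum degree and essential connectivity\<close>

definition min_degree :: "'a pair_pre_digraph \<Rightarrow> nat" where
  "min_degree G = Min (out_degree (with_proj G) ` pverts G)"

definition trivial_graph :: "('a, 'b) pre_digraph \<Rightarrow> bool" where
  "trivial_graph H \<longleftrightarrow> card (verts H) = 1 \<and> arcs H = {}"

definition essential_vertex_cut :: "'a pair_pre_digraph \<Rightarrow> 'a set \<Rightarrow> bool" where
  "essential_vertex_cut G S \<longleftrightarrow> S \<subseteq> pverts G \<and>
     card {C \<in> pre_digraph.sccs (with_proj G \<restriction> (pverts G - S)). \<not> trivial_graph C} \<ge> 2"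

text \<open>Only meaningful for graphs that have an essential vertex cut.\<close>

definition essential_connectivity :: "'a pair_pre_digraph \<Rightarrow> nat" where
  "essential_connectivity G = Min (card ` {S. essential_vertex_cut G S})"


section \<open>The extremal graph\<close>

text \<open>The complete graph on the \<open>m\<close> vertices \<open>a, \<dots>, a + m - 1\<close>.\<close>

definition complete_block :: "nat \<Rightarrow> nat \<Rightarrow> nat pair_pre_digraph" where
  "complete_block a m =
     \<lparr> pverts = {a..<a + m}, parcs = {(v, w). v \<in> {a..<a + m} \<and> w \<in> {a..<a + m} \<and> v \<noteq> w} \<rparr>"

text \<open>Union and join are only used for graphs with disjoint vertex sets.\<close>

definition graph_union ::
    "'a pair_pre_digraph \<Rightarrow> 'a pair_pre_digraph \<Rightarrow> 'a pair_pre_digraph" where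
  "graph_union G H = \<lparr> pverts = pverts G \<union> pverts H, parcs = parcs G \<union> parcs H \<rparr>"

definition graph_join ::
    "'a pair_pre_digraph \<Rightarrow> 'a pair_pre_digraph \<Rightarrow> 'a pair_pre_digraph" where
  "graph_join G H =
     \<lparr> pverts = pverts G \<union> pverts H,
       parcs = parcs G \<union> parcs H \<union> pverts G \<times> pverts H \<union> pverts H \<times> pverts G \<rparr>"

definition add_vertex :: "'a \<Rightarrow> 'a set \<Rightarrow> 'a pair_pre_digraph \<Rightarrow> 'a pair_pre_digraph" where
  "add_vertex u N G =
     \<lparr> pverts = insert u (pverts G), parcs = parcs G \<union> {u} \<times> N \<union> N \<times> {u} \<rparr>"

text \<open>
  The vertex set is \<open>{0..<n}\<close> and the first \<open>\<kappa>\<close> vertices always form the joined clique. In the first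
  case the vertex \<open>\<kappa>\<close> is the single vertex of $K_1$, and the last vertex \<open>n - 1\<close> is attached to it
  and to \<open>\<delta> - 1\<close> vertices of the clique. All truncated subtractions are exact if \<open>\<delta> \<ge> 1\<close>,
  \<open>n \<ge> \<kappa> + 2\<close> and \<open>n \<ge> \<delta> + 1\<close>.
\<close>

definition extremal_graph :: "nat \<Rightarrow> nat \<Rightarrow> nat \<Rightarrow> nat pair_pre_digraph" where
  "extremal_graph n \<kappa> \<delta> =
     (if \<kappa> > \<delta> - 1 then
        add_vertex (n - 1) ({0..<\<delta> - 1} \<union> {\<kappa>})
          (graph_join (complete_block 0 \<kappa>)
            (graph_union (complete_block \<kappa> 1) (complete_block (\<kappa> + 1) (n - \<kappa> - 2))))
      else
        graph_join (complete_block 0 \<kappa>)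
          (graph_union (complete_block \<kappa> (n - \<delta> - 1))
            (complete_block (\<kappa> + (n - \<delta> - 1)) (\<delta> - \<kappa> + 1))))"

end

theory Submission
  imports Defs "HOL-Analysis.Function_Topology"
begin

text \<open>
  The spectral radius is the maximum of the Rayleigh quotient, so it suffices to compare the
  quadratic form \<open>\<Sum>x\<^sub>vx\<^sub>w\<close> (over the arcs) of \<open>G\<close> and of a copy of the extremal graph on the same
  vertices, at a positive eigenvector \<open>x\<close> of \<open>G\<close>. Both forms are \<open>(\<Sum>x\<^sub>v)\<^sup>2 - \<Sum>x\<^sub>v\<^sup>2\<close> minus the
  contribution of the non-edges. Let \<open>S\<close> be a minimum essential cut separating \<open>A\<close> from \<open>B\<close>.

  If \<open>\<kappa> < \<delta>\<close>, the minimum degree gives \<open>|A|, |B| \<ge> \<delta> - \<kappa> + 1\<close>; keeping \<open>\<delta> - \<kappa> + 1\<close> vertices of the lighter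
  side and moving its other vertices to the heavier one decreases the product of the two weights.

  If \<open>\<delta> \<le> \<kappa>\<close>, let \<open>u\<close> be a vertex of degree \<open>\<delta>\<close>. The pendant pair \<open>u', v\<close> of the extremal graph is
  chosen among \<open>u\<close>, its neighbours in \<open>A \<union> B\<close>, and vertices of the other side, and the pair is
  attached to the heaviest remaining vertices. If \<open>u \<in> S\<close>, minimality of \<open>S\<close> provides neighbours of \<open>u\<close>
  on both sides, and \<open>v\<close> is the lighter of the two. If \<open>u \<in> A\<close> has a neighbour in \<open>A\<close>, either
  \<open>G\<close> is a spanning subgraph of the extremal graph or one of three choices gives a strictly larger form.
  If \<open>u\<close> has no neighbour outside \<open>S\<close>, an arbitrary positive \<open>x\<close> does not suffice; one passes to the
  maximal graph of this shape and uses its eigenvalue equations.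
\<close>

section \<open>Rayleigh quotient and Perron vector\<close>

definition quad :: "'a rel \<Rightarrow> ('a \<Rightarrow> real) \<Rightarrow> real" where
  "quad E x = (\<Sum>(v, w)\<in>E. x v * x w)"

text \<open>Several relations on one vertex set are compared throughout, so graphs are handled as a
  vertex set together with a relation.\<close>

definition mk_graph :: "'a set \<Rightarrow> 'a rel \<Rightarrow> 'a pair_pre_digraph" where
  "mk_graph V E = \<lparr> pverts = V, parcs = E \<rparr>"

lemma finite_rel:
  assumes "finite V" "E \<subseteq> V \<times> V"
  shows "finite E"
  using assms by (meson finite_SigmaI finite_subset)

lemma finite_Image_rel:
  assumes "finite V" "E \<subseteq> V \<times> V"
  shows "finite (E `` P)"
  using assms by (intro finite_subset[OF _ assms(1)]) auto

lemma quad_altdef: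
  assumes "finite V" "E \<subseteq> V \<times> V"
  shows "quad E x = (\<Sum>v\<in>V. x v * sum x (E `` {v}))"
proof -
  have "E = (SIGMA v:V. E `` {v})" using assms by auto
  moreover have "finite (E `` {v})" for v
    by (rule finite_Image_rel[OF assms(1,2)])
  ultimately have "quad E x = (\<Sum>v\<in>V. \<Sum>w\<in>E `` {v}. x v * x w)"
    unfolding quad_def using sum.Sigma[OF assms(1), of "\<lambda>v. E `` {v}" "\<lambda>v w. x v * x w"] by simp
  then show ?thesis by (simp add: sum_distrib_left)
qed

text \<open>Compactness of the unit sphere yields a maximizer and homogeneity extends the bound to
  all \<open>y\<close>. Taking absolute values of the coordinates cannot lower the form, which makes
  the maximizer nonnegative.\<close>

lemma rayleigh_maximizer:
  fixes E :: "'a rel"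
  assumes V: "finite V" "V \<noteq> {}" and E: "E \<subseteq> V \<times> V"
  obtains x k where "\<And>v. v \<in> V \<Longrightarrow> x v \<ge> 0" "(\<Sum>v\<in>V. (x v)\<^sup>2) = 1" "quad E x = k"
    "\<And>y. quad E y \<le> k * (\<Sum>v\<in>V. (y v)\<^sup>2)"
proof -
  \<comment> \<open>Coordinates outside \<open>V\<close> are pinned to 0, so the box is a product of
    compact sets over the whole vertex type and Tychonoff applies even if that type is
    infinite.\<close>
  define B :: "('a \<Rightarrow> real) set" where "B = PiE UNIV (\<lambda>v. if v \<in> V then {-1..1} else {0})"
  define K where "K = B \<inter> {x. (\<Sum>v\<in>V. (x v)\<^sup>2) = 1}"
  have "compact B"
    unfolding B_def using compactin_PiE[of "\<lambda>_. euclidean" UNIV "\<lambda>v. if v \<in> V then {-1..1::real} else {0}"]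
    by (auto simp: euclidean_product_topology)
  moreover have "closed {x :: 'a \<Rightarrow> real. (\<Sum>v\<in>V. (x v)\<^sup>2) = 1}"
    by (intro closed_Collect_eq continuous_intros continuous_on_product_coordinates)
  ultimately have "compact K" unfolding K_def by (rule compact_Int_closed)
  obtain v0 where v0: "v0 \<in> V" using V by auto
  have "(\<Sum>v\<in>V. (if v = v0 then 1 else 0 :: real)\<^sup>2) = (\<Sum>v\<in>V. if v = v0 then 1 else 0)"
    by (intro sum.cong) auto
  then have "(\<lambda>v. if v = v0 then 1 else 0) \<in> K"
    unfolding K_def B_def PiE_UNIV_domain using v0 V(1) by simp
  then have "K \<noteq> {}" by auto
  moreover have "continuous_on K (quad E)"
    unfolding quad_def case_prod_beta
    by (intro continuous_intros continuous_on_subset[OF continuous_on_product_coordinates]) auto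
  ultimately obtain z where z: "z \<in> K" "\<And>y. y \<in> K \<Longrightarrow> quad E y \<le> quad E z"
    using continuous_attains_sup[OF \<open>compact K\<close>] by blast
  have max: "quad E y \<le> quad E z * (\<Sum>v\<in>V. (y v)\<^sup>2)" for y
  proof (cases "\<forall>v\<in>V. y v = 0")
    case True
    then have "quad E y = 0" unfolding quad_altdef[OF V(1) E] by simp
    then show ?thesis using True by simp
  next
    case False
    define s where "s = (\<Sum>v\<in>V. (y v)\<^sup>2)"
    have s: "s > 0"
    proof -
      obtain v where "v \<in> V" "y v \<noteq> 0" using False by auto
      then have "0 < (y v)\<^sup>2" "(y v)\<^sup>2 \<le> s" unfolding s_def using V by (auto intro!: member_le_sum)
      then show ?thesis by linarith
    qed
    define y' where "y' v = (if v \<in> V then y v / sqrt s else 0)" for v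
    have "(\<Sum>v\<in>V. (y' v)\<^sup>2) = 1"
      using s by (simp add: y'_def power_divide flip: sum_divide_distrib s_def)
    moreover from this have "(y' v)\<^sup>2 \<le> 1" if "v \<in> V" for v
      using member_le_sum[OF that, of "\<lambda>v. (y' v)\<^sup>2"] V by simp
    then have "\<bar>y' v\<bar> \<le> 1" if "v \<in> V" for v using that abs_square_le_1 by blast
    then have "y' v \<in> {-1..1}" if "v \<in> V" for v using that by (force simp: abs_le_iff)
    then have "y' v \<in> (if v \<in> V then {-1..1} else {0})" for v
      using y'_def by (cases "v \<in> V") auto
    then have "y' \<in> B" unfolding B_def PiE_UNIV_domain by blast
    ultimately have "quad E y' \<le> quad E z" using z(2) by (simp add: K_def)
    moreover have "quad E y' = quad E y / s"
    proof -
      have "quad E y' = (\<Sum>(v, w)\<in>E. y v * y w / s)"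
        unfolding quad_def using E s by (intro sum.cong) (auto simp: y'_def)
      then show ?thesis by (simp add: quad_def sum_divide_distrib case_prod_beta)
    qed
    ultimately show ?thesis using s by (simp add: field_simps s_def)
  qed
  define x where "x v = \<bar>z v\<bar>" for v
  have x1: "(\<Sum>v\<in>V. (x v)\<^sup>2) = 1" using z(1) by (simp add: x_def K_def)
  have "quad E z \<le> quad E x"
    unfolding quad_def case_prod_beta x_def
    by (intro sum_mono) (metis abs_ge_self abs_mult)
  then have "quad E x = quad E z" using max[of x] x1 by simp
  then show thesis using that[of x "quad E z"] x1 max by (simp add: x_def)
qed

text \<open>Near \<open>t = 0\<close> the linear term dominates. The test value
  \<open>t = D / m\<close>, with \<open>m\<close> exceeding the absolute value of \<open>C\<close>,
  is small enough and has the sign of \<open>D\<close>.\<close>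

lemma quadratic_nonpos_imp_zero:
  fixes C D :: real
  assumes "\<And>t. 2 * t * D + t\<^sup>2 * C \<le> 0"
  shows "D = 0"
proof (rule ccontr)
  assume D: "D \<noteq> 0"
  define m where "m = \<bar>C\<bar> + 1"
  have m: "m > 0" "C \<ge> - m" by (auto simp: m_def)
  have "2 * D\<^sup>2 * m + D\<^sup>2 * C = (2 * (D / m) * D + (D / m)\<^sup>2 * C) * m\<^sup>2"
    using m by (simp add: field_simps power2_eq_square)
  also have "\<dots> \<le> 0"
    using mult_right_mono[OF assms[of "D / m"], of "m\<^sup>2"] by simp
  finally have "2 * D\<^sup>2 * m + D\<^sup>2 * C \<le> 0" .
  moreover have "2 * D\<^sup>2 * m + D\<^sup>2 * C \<ge> D\<^sup>2 * m"
    using mult_left_mono[OF m(2), of "D\<^sup>2"] by (simp add: algebra_simps)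
  moreover have "D\<^sup>2 * m > 0" using D m by simp
  ultimately show False by linarith
qed

text \<open>First-order condition: changing only the coordinate at \<open>v\<close> by
  \<open>t\<close> turns the Rayleigh bound into a quadratic inequality in \<open>t\<close> whose
  linear coefficient is twice the defect of the eigenvalue equation at \<open>v\<close>.\<close>

lemma rayleigh_maximizer_eigen:
  assumes V: "finite V" and E: "E \<subseteq> V \<times> V" and sym: "sym E"
    and max: "\<And>y. quad E y \<le> k * (\<Sum>v\<in>V. (y v)\<^sup>2)"
    and x: "quad E x = k * (\<Sum>v\<in>V. (x v)\<^sup>2)"
    and v: "v \<in> V"
  shows "sum x (E `` {v}) = k * x v"
proof -
  have finI: "finite (E `` {p})" for p
    by (rule finite_Image_rel[OF assms(1,2)])
  \<comment> \<open>Column \<open>v\<close> of the adjacency matrix; \<open>c v\<close> accounts for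
    a possible loop at \<open>v\<close>.\<close>
  define c where "c p = (if (p, v) \<in> E then 1 else 0 :: real)" for p
  let ?d = "\<lambda>p. if p = v then 1 else 0 :: real"
  have "2 * t * (sum x (E `` {v}) - k * x v) + t\<^sup>2 * (c v - k) \<le> 0" for t
  proof -
    let ?y = "\<lambda>p. x p + t * ?d p"
    have L: "sum ?y (E `` {p}) = sum x (E `` {p}) + t * c p" for p
      using finI[of p] by (simp add: sum.distrib c_def flip: sum_distrib_left)
    have "quad E ?y = (\<Sum>p\<in>V. (x p + t * ?d p) * (sum x (E `` {p}) + t * c p))"
      unfolding quad_altdef[OF V E] L ..
    also have "\<dots> = (\<Sum>p\<in>V. x p * sum x (E `` {p}) + t * (x p * c p)
        + (if p = v then t * sum x (E `` {v}) + t * t * c v else 0))"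
      by (intro sum.cong) (auto simp: algebra_simps)
    also have "\<dots> = quad E x + t * (\<Sum>p\<in>V. x p * c p) + t * sum x (E `` {v}) + t * t * c v"
      using V v by (simp add: sum.distrib quad_altdef[OF V E] flip: sum_distrib_left)
    also have "(\<Sum>p\<in>V. x p * c p) = (\<Sum>p\<in>E `` {v}. x p)"
    proof -
      have "E `` {v} = {p\<in>V. (p, v) \<in> E}" using E sym by (auto dest: symD)
      then show ?thesis by (simp add: c_def if_distrib sum.inter_filter[OF V] cong: if_cong)
    qed
    finally have q: "quad E ?y = quad E x + 2 * t * sum x (E `` {v}) + t * t * c v" by simp
    have "(\<Sum>p\<in>V. (?y p)\<^sup>2) = (\<Sum>p\<in>V. (x p)\<^sup>2 + (if p = v then 2 * t * x v + t * t else 0))"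
      by (intro sum.cong) (auto simp: algebra_simps power2_eq_square)
    then have s: "(\<Sum>p\<in>V. (?y p)\<^sup>2) = (\<Sum>p\<in>V. (x p)\<^sup>2) + 2 * t * x v + t * t"
      using V v by (simp add: sum.distrib)
    show ?thesis using max[of ?y] unfolding q s x by (simp add: algebra_simps power2_eq_square)
  qed
  from quadratic_nonpos_imp_zero[OF this] show ?thesis by simp
qed

text \<open>The first part removes the chosen enumeration of the vertices. Finiteness, from the
  roots of the characteristic polynomial, makes the \<open>Max\<close> in the spectral radius
  meaningful.\<close>

lemma spectrum_eq:
  fixes E :: "'a rel"
  assumes V: "finite V" and E: "E \<subseteq> V \<times> V"
  defines "vs \<equiv> (SOME vs. distinct vs \<and> set vs = V)"
  shows "{k. eigenvalue (adjacency_matrix (mk_graph V E) vs) k} =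
    {k. \<exists>f. (\<exists>v\<in>V. f v \<noteq> 0) \<and> (\<forall>v\<in>V. sum f (E `` {v}) = k * f v)}"
    and "finite {k. eigenvalue (adjacency_matrix (mk_graph V E) vs) k}"
proof -
  have vs: "distinct vs" "set vs = V"
    using someI_ex[of "\<lambda>vs. distinct vs \<and> set vs = V"] finite_distinct_list[OF V] unfolding vs_def by auto
  have "{w\<in>V. (v, w) \<in> E} = E `` {v}" for v using E by auto
  then show "{k. eigenvalue (adjacency_matrix (mk_graph V E) vs) k} =
    {k. \<exists>f. (\<exists>v\<in>V. f v \<noteq> 0) \<and> (\<forall>v\<in>V. sum f (E `` {v}) = k * f v)}"
    unfolding eigenvalue_adjacency_matrix[OF vs(1)] vs by (simp add: mk_graph_def)
  have A: "adjacency_matrix (mk_graph V E) vs \<in> carrier_mat (length vs) (length vs)"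
    by (simp add: adjacency_matrix_def)
  have "char_poly (adjacency_matrix (mk_graph V E) vs) \<noteq> 0"
    using degree_monic_char_poly[OF A] by auto
  then show "finite {k. eigenvalue (adjacency_matrix (mk_graph V E) vs) k}"
    unfolding eigenvalue_root_char_poly[OF A] by (rule poly_roots_finite)
qed

lemma spectral_radius_eq_Max:
  assumes "finite V" "E \<subseteq> V \<times> V"
  shows "graph_spectral_radius (mk_graph V E) =
    Max {k. \<exists>f. (\<exists>v\<in>V. f v \<noteq> 0) \<and> (\<forall>v\<in>V. sum f (E `` {v}) = k * f v)}"
  unfolding spectrum_eq(1)[OF assms, symmetric] by (simp add: graph_spectral_radius_def mk_graph_def)

text \<open>Every eigenvalue is the Rayleigh quotient of its eigenvector, so an eigenvalue that
  bounds all Rayleigh quotients is the largest one.\<close>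

lemma spectral_radius_eqI:
  fixes E :: "'a rel"
  assumes V: "finite V" and E: "E \<subseteq> V \<times> V"
    and max: "\<And>y. quad E y \<le> k * (\<Sum>v\<in>V. (y v)\<^sup>2)"
    and x: "\<exists>v\<in>V. x v \<noteq> 0" "\<And>v. v \<in> V \<Longrightarrow> sum x (E `` {v}) = k * x v"
  shows "graph_spectral_radius (mk_graph V E) = k"
  unfolding spectral_radius_eq_Max[OF V E]
proof (rule Max_eqI)
  show "finite {k. \<exists>f :: 'a \<Rightarrow> real. (\<exists>v\<in>V. f v \<noteq> 0) \<and> (\<forall>v\<in>V. sum f (E `` {v}) = k * f v)}"
    using spectrum_eq(2)[OF V E] unfolding spectrum_eq(1)[OF V E] .
  show "k \<in> {k. \<exists>f :: 'a \<Rightarrow> real. (\<exists>v\<in>V. f v \<noteq> 0) \<and> (\<forall>v\<in>V. sum f (E `` {v}) = k * f v)}"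
    using x by blast
  fix l assume "l \<in> {k. \<exists>f :: 'a \<Rightarrow> real. (\<exists>v\<in>V. f v \<noteq> 0) \<and> (\<forall>v\<in>V. sum f (E `` {v}) = k * f v)}"
  then obtain f v where f: "v \<in> V" "f v \<noteq> 0" "\<And>v. v \<in> V \<Longrightarrow> sum f (E `` {v}) = l * f v" by blast
  have "quad E f = l * (\<Sum>v\<in>V. (f v)\<^sup>2)"
    unfolding quad_altdef[OF V E] by (simp add: f(3) sum_distrib_left power2_eq_square algebra_simps)
  moreover have "(f v)\<^sup>2 \<le> (\<Sum>v\<in>V. (f v)\<^sup>2)"
    using V f by (intro member_le_sum) auto
  then have "(\<Sum>v\<in>V. (f v)\<^sup>2) > 0" using f(2) zero_less_power2[of "f v"] by linarith
  ultimately show "l \<le> k" using max[of f] by simp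
qed

lemma rayleigh:
  assumes V: "finite V" "V \<noteq> {}" and E: "E \<subseteq> V \<times> V" and sym: "sym E"
  shows "quad E y \<le> graph_spectral_radius (mk_graph V E) * (\<Sum>v\<in>V. (y v)\<^sup>2)"
    and "\<exists>x. (\<forall>v\<in>V. x v \<ge> 0) \<and> (\<exists>v\<in>V. x v \<noteq> 0) \<and>
      (\<forall>v\<in>V. sum x (E `` {v}) = graph_spectral_radius (mk_graph V E) * x v)"
proof -
  obtain x k where x: "\<And>v. v \<in> V \<Longrightarrow> x v \<ge> 0" "(\<Sum>v\<in>V. (x v)\<^sup>2) = 1" "quad E x = k"
    and max: "\<And>y. quad E y \<le> k * (\<Sum>v\<in>V. (y v)\<^sup>2)"
    using rayleigh_maximizer[OF V E] by metis
  have eig: "sum x (E `` {v}) = k * x v" if "v \<in> V" for v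
    using rayleigh_maximizer_eigen[OF V(1) E sym max _ that, of x] x by simp
  have nz: "\<exists>v\<in>V. x v \<noteq> 0" using x(2) by (rule contrapos_pp) simp
  have "graph_spectral_radius (mk_graph V E) = k"
    by (rule spectral_radius_eqI[OF V(1) E max nz eig])
  then show "quad E y \<le> graph_spectral_radius (mk_graph V E) * (\<Sum>v\<in>V. (y v)\<^sup>2)"
    and "\<exists>x. (\<forall>v\<in>V. x v \<ge> 0) \<and> (\<exists>v\<in>V. x v \<noteq> 0) \<and>
      (\<forall>v\<in>V. sum x (E `` {v}) = graph_spectral_radius (mk_graph V E) * x v)"
    using max x(1) eig nz by auto
qed

section \<open>Connectivity and strict comparison of spectral radii\<close>

text \<open>For a symmetric relation on \<open>V\<close> this is ordinary connectivity. The
  closed-set form fits its main use, the zero set of a nonnegative eigenvector.\<close>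

definition connected_rel :: "'a set \<Rightarrow> 'a rel \<Rightarrow> bool" where
  "connected_rel V E \<longleftrightarrow> (\<forall>P\<subseteq>V. P \<noteq> {} \<longrightarrow> E `` P \<subseteq> P \<longrightarrow> P = V)"

lemma connected_rel_mono: "connected_rel V E \<Longrightarrow> E \<subseteq> F \<Longrightarrow> connected_rel V F"
  unfolding connected_rel_def by (meson Image_mono order_refl order_trans)

text \<open>The zero set of a nonnegative eigenvector is closed under neighbours, because a
  vanishing sum of nonnegative terms vanishes termwise. Connectivity forces this set to be
  empty.\<close>

lemma perron_vector:
  assumes V: "finite V" "V \<noteq> {}" and E: "E \<subseteq> V \<times> V" and sym: "sym E" and conn: "connected_rel V E"
  obtains x where "\<And>v. v \<in> V \<Longrightarrow> x v > 0"
    "\<And>v. v \<in> V \<Longrightarrow> sum x (E `` {v}) = graph_spectral_radius (mk_graph V E) * x v"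
    "quad E x = graph_spectral_radius (mk_graph V E) * (\<Sum>v\<in>V. (x v)\<^sup>2)"
    "(\<Sum>v\<in>V. (x v)\<^sup>2) > 0"
proof -
  let ?k = "graph_spectral_radius (mk_graph V E)"
  obtain x where x: "\<And>v. v \<in> V \<Longrightarrow> x v \<ge> 0" "\<exists>v\<in>V. x v \<noteq> 0"
    and eig: "\<And>v. v \<in> V \<Longrightarrow> sum x (E `` {v}) = ?k * x v"
    using rayleigh(2)[OF V E sym] by metis
  define Z where "Z = {v\<in>V. x v = 0}"
  have "E `` Z \<subseteq> Z"
  proof
    fix w assume "w \<in> E `` Z"
    then obtain v where v: "(v, w) \<in> E" "v \<in> V" "x v = 0" by (auto simp: Z_def)
    have "finite (E `` {v})" by (rule finite_Image_rel[OF V(1) E])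
    moreover have "sum x (E `` {v}) = 0" using eig[OF v(2)] v(3) by simp
    ultimately have "x w = 0"
      using v(1) x(1) E by (subst (asm) sum_nonneg_eq_0_iff) auto
    then show "w \<in> Z" using v E by (auto simp: Z_def)
  qed
  moreover have "Z \<noteq> V" "Z \<subseteq> V" using x(2) by (auto simp: Z_def)
  ultimately have "Z = {}" using conn unfolding connected_rel_def by blast
  then have pos: "x v > 0" if "v \<in> V" for v using x(1)[OF that] that by (auto simp: Z_def less_le)
  show thesis
  proof (rule that[OF pos eig])
    show "quad E x = ?k * (\<Sum>v\<in>V. (x v)\<^sup>2)"
      unfolding quad_altdef[OF V(1) E] by (simp add: eig sum_distrib_left power2_eq_square algebra_simps)
    show "(\<Sum>v\<in>V. (x v)\<^sup>2) > 0" using V pos by (intro sum_pos) (auto dest!: pos)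
  qed
qed

text \<open>Test-vector principle: a vector with Rayleigh quotient \<open>k\<close> for
  \<open>E\<close> has a larger quotient for \<open>F\<close>, and the spectral radius of
  \<open>F\<close> bounds that from above. Comparisons of forms become comparisons of radii
  here.\<close>

lemma spectral_radius_less:
  assumes V: "finite V" "V \<noteq> {}" and F: "F \<subseteq> V \<times> V" "sym F"
    and x: "quad E x = k * (\<Sum>v\<in>V. (x v)\<^sup>2)" "(\<Sum>v\<in>V. (x v)\<^sup>2) > 0" and less: "quad E x < quad F x"
  shows "k < graph_spectral_radius (mk_graph V F)"
proof -
  have "k * (\<Sum>v\<in>V. (x v)\<^sup>2) < graph_spectral_radius (mk_graph V F) * (\<Sum>v\<in>V. (x v)\<^sup>2)"
    using rayleigh(1)[OF V F, of x] less unfolding x(1) by linarith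
  then show ?thesis by (rule mult_right_less_imp_less) (use x(2) in simp)
qed

text \<open>At the Perron vector of \<open>E\<close>, positive by connectivity, every arc of
  \<open>F - E\<close> contributes a positive amount.\<close>

lemma spectral_radius_strict_mono:
  assumes V: "finite V" "V \<noteq> {}" and E: "sym E" "connected_rel V E"
    and F: "F \<subseteq> V \<times> V" "sym F" and sub: "E \<subset> F"
  shows "graph_spectral_radius (mk_graph V E) < graph_spectral_radius (mk_graph V F)"
proof -
  have EV: "E \<subseteq> V \<times> V" using F sub by auto
  obtain x where x: "\<And>v. v \<in> V \<Longrightarrow> x v > 0"
    "quad E x = graph_spectral_radius (mk_graph V E) * (\<Sum>v\<in>V. (x v)\<^sup>2)" "(\<Sum>v\<in>V. (x v)\<^sup>2) > 0"
    by (rule perron_vector[OF V EV E]) blast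
  have "finite F" by (rule finite_rel[OF V(1) F(1)])
  obtain p q where pq: "(p, q) \<in> F - E" using sub by auto
  then have "0 < quad (F - E) x"
    unfolding quad_def case_prod_beta using \<open>finite F\<close> x(1) F(1)
    by (intro sum_pos) (auto intro!: mult_pos_pos)
  moreover have "quad F x = quad (F - E) x + quad E x"
    unfolding quad_def using sub \<open>finite F\<close> by (intro sum.subset_diff) auto
  ultimately have "quad E x < quad F x" by simp
  then show ?thesis by (rule spectral_radius_less[OF V F x(2,3)])
qed

section \<open>Isomorphism and essential cuts\<close>

definition rel_iso :: "('a \<Rightarrow> 'b) \<Rightarrow> 'a set \<Rightarrow> 'a rel \<Rightarrow> 'b set \<Rightarrow> 'b rel \<Rightarrow> bool" where
  "rel_iso \<sigma> V E W F \<longleftrightarrow> bij_betw \<sigma> V W \<and> (\<forall>v\<in>V. \<forall>w\<in>V. (v, w) \<in> E \<longleftrightarrow> (\<sigma> v, \<sigma> w) \<in> F)"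

lemma rel_iso_image:
  assumes "rel_iso \<sigma> V E W F" "E \<subseteq> V \<times> V" "F \<subseteq> W \<times> W"
  shows "F = map_prod \<sigma> \<sigma> ` E" "W = \<sigma> ` V"
proof -
  show W: "W = \<sigma> ` V" using assms(1) by (auto simp: rel_iso_def bij_betw_def)
  show "F = map_prod \<sigma> \<sigma> ` E"
  proof (intro Set.set_eqI iffI)
    fix e assume e: "e \<in> F"
    then obtain v w where "e = (\<sigma> v, \<sigma> w)" "v \<in> V" "w \<in> V" using assms(3) W by auto
    moreover from this have "(v, w) \<in> E" using assms(1) e by (auto simp: rel_iso_def)
    ultimately show "e \<in> map_prod \<sigma> \<sigma> ` E" by force
  next
    fix e assume "e \<in> map_prod \<sigma> \<sigma> ` E"
    then show "e \<in> F" using assms(1,2) by (auto simp: rel_iso_def)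
  qed
qed

text \<open>\<open>with_proj\<close> fixes tail and head as the two projections, so the arc map of
  an isomorphism is determined by its vertex map. Hence \<open>rel_iso\<close> records a vertex
  bijection alone.\<close>

lemma digraph_iso_mk_graph:
  assumes E: "E \<subseteq> V \<times> V" and F: "F \<subseteq> W \<times> W"
  shows "digraph_iso (with_proj (mk_graph V E)) (with_proj (mk_graph W F)) \<longleftrightarrow> (\<exists>\<sigma>. rel_iso \<sigma> V E W F)"
proof
  assume "digraph_iso (with_proj (mk_graph V E)) (with_proj (mk_graph W F))"
  then obtain h where h: "pre_digraph.digraph_isomorphism (with_proj (mk_graph V E)) h"
    and app: "with_proj (mk_graph W F) = app_iso h (with_proj (mk_graph V E))"
    by (auto simp: digraph_iso_def)
  let ?\<sigma> = "iso_verts h"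
  have W: "W = ?\<sigma> ` V" and FA: "F = iso_arcs h ` E"
    and t: "iso_tail h = fst" and hd: "iso_head h = snd"
    using app by (auto simp: app_iso_def with_proj_def mk_graph_def)
  have inj: "inj_on ?\<sigma> V"
    and ar: "\<And>a. a \<in> E \<Longrightarrow> ?\<sigma> (fst a) = fst (iso_arcs h a) \<and> ?\<sigma> (snd a) = snd (iso_arcs h a)"
    using h by (auto simp: pre_digraph.digraph_isomorphism_def mk_graph_def t hd)
  have img: "iso_arcs h a = (?\<sigma> (fst a), ?\<sigma> (snd a))" if "a \<in> E" for a
    using ar[OF that] by (simp add: prod_eq_iff)
  have "rel_iso ?\<sigma> V E W F"
    unfolding rel_iso_def
  proof (intro conjI ballI iffI)
    show "bij_betw ?\<sigma> V W" using inj W by (simp add: bij_betw_def)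
    fix v w assume vw: "v \<in> V" "w \<in> V"
    show "(?\<sigma> v, ?\<sigma> w) \<in> F" if "(v, w) \<in> E" using img[OF that] that FA by (metis fst_conv image_eqI snd_conv)
    assume "(?\<sigma> v, ?\<sigma> w) \<in> F"
    then obtain a where a: "a \<in> E" "(?\<sigma> v, ?\<sigma> w) = (?\<sigma> (fst a), ?\<sigma> (snd a))" using FA img by auto
    moreover have "fst a \<in> V" "snd a \<in> V" using a(1) E by auto
    ultimately have "fst a = v" "snd a = w" using inj vw by (auto dest: inj_onD)
    then show "(v, w) \<in> E" using a(1) by auto
  qed
  then show "\<exists>\<sigma>. rel_iso \<sigma> V E W F" by blast
next
  assume "\<exists>\<sigma>. rel_iso \<sigma> V E W F"
  then obtain \<sigma> where s: "rel_iso \<sigma> V E W F" by blast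
  note im = rel_iso_image[OF s E F]
  let ?h = "\<lparr>iso_verts = \<sigma>, iso_arcs = map_prod \<sigma> \<sigma>, iso_head = snd, iso_tail = fst\<rparr>"
  have inj: "inj_on \<sigma> V" using s by (auto simp: rel_iso_def bij_betw_def)
  have "inj_on (map_prod \<sigma> \<sigma>) E"
    using map_prod_inj_on[OF inj inj] E inj_on_subset by blast
  moreover have "wf_digraph (with_proj (mk_graph V E))"
    using E by (auto simp: wf_digraph_def mk_graph_def)
  ultimately have "pre_digraph.digraph_isomorphism (with_proj (mk_graph V E)) ?h"
    using inj by (auto simp: pre_digraph.digraph_isomorphism_def mk_graph_def)
  moreover have "with_proj (mk_graph W F) = app_iso ?h (with_proj (mk_graph V E))"
    by (simp add: app_iso_def mk_graph_def with_proj_def im)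
  ultimately show "digraph_iso (with_proj (mk_graph V E)) (with_proj (mk_graph W F))"
    unfolding digraph_iso_def by blast
qed

text \<open>Eigenvectors pull back along \<open>\<sigma>\<close>. The reverse inclusion of spectra
  comes from the inverse bijection.\<close>

lemma rel_iso_spectrum_mono:
  fixes E :: "'a rel" and F :: "'b rel"
  assumes s: "rel_iso \<sigma> V E W F" and E: "E \<subseteq> V \<times> V" and F: "F \<subseteq> W \<times> W"
    and f: "\<exists>v\<in>W. f v \<noteq> (0 :: real)" "\<forall>v\<in>W. sum f (F `` {v}) = k * f v"
  shows "\<exists>f. (\<exists>v\<in>V. f v \<noteq> (0 :: real)) \<and> (\<forall>v\<in>V. sum f (E `` {v}) = k * f v)"
proof (intro exI conjI ballI)
  note im = rel_iso_image[OF s E F]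
  have inj: "inj_on \<sigma> V" using s by (auto simp: rel_iso_def bij_betw_def)
  show "\<exists>v\<in>V. (f \<circ> \<sigma>) v \<noteq> 0" using f(1) im by auto
  fix v assume v: "v \<in> V"
  have "E `` {v} \<subseteq> V" using E by auto
  then have "inj_on \<sigma> (E `` {v})" using inj inj_on_subset by blast
  moreover have "F `` {\<sigma> v} = \<sigma> ` (E `` {v})"
  proof (intro Set.set_eqI iffI)
    fix w assume "w \<in> F `` {\<sigma> v}"
    then obtain a b where ab: "(a, b) \<in> E" "\<sigma> v = \<sigma> a" "w = \<sigma> b" using im by auto
    then have "a = v" using inj v E by (auto dest: inj_onD)
    then show "w \<in> \<sigma> ` (E `` {v})" using ab by auto
  next
    fix w assume "w \<in> \<sigma> ` (E `` {v})"
    then show "w \<in> F `` {\<sigma> v}" using im by force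
  qed
  ultimately have "sum (f \<circ> \<sigma>) (E `` {v}) = sum f (F `` {\<sigma> v})"
    by (simp add: sum.reindex)
  then show "sum (f \<circ> \<sigma>) (E `` {v}) = k * (f \<circ> \<sigma>) v" using f(2) im v by auto
qed

lemma rel_iso_inv:
  assumes "rel_iso \<sigma> V E W F"
  shows "rel_iso (the_inv_into V \<sigma>) W F V E"
proof -
  have b: "bij_betw \<sigma> V W" using assms by (simp add: rel_iso_def)
  have inv: "\<sigma> (the_inv_into V \<sigma> w) = w" "the_inv_into V \<sigma> w \<in> V" if "w \<in> W" for w
    using b that by (auto simp: bij_betw_def f_the_inv_into_f the_inv_into_into)
  then show ?thesis
    using assms bij_betw_the_inv_into[OF b] unfolding rel_iso_def by metis
qed

lemma rel_iso_spectral_radius: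
  fixes E :: "'a rel" and F :: "'b rel"
  assumes V: "finite V" and E: "E \<subseteq> V \<times> V" and F: "F \<subseteq> W \<times> W" and s: "rel_iso \<sigma> V E W F"
  shows "graph_spectral_radius (mk_graph V E) = graph_spectral_radius (mk_graph W F)"
proof -
  have W: "finite W" using s V by (auto simp: rel_iso_def bij_betw_finite)
  show ?thesis
    unfolding spectral_radius_eq_Max[OF V E] spectral_radius_eq_Max[OF W F]
    by (intro arg_cong[of _ _ Max] Collect_cong iffI)
      (use rel_iso_spectrum_mono[OF s E F] rel_iso_spectrum_mono[OF rel_iso_inv[OF s] F E] in blast)+
qed

section \<open>Translation of connectivity and minimum degree to relations\<close>

lemma mk_graph_collapse [simp]: "mk_graph (pverts G) (parcs G) = G"
  by (simp add: mk_graph_def)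

lemma pair_graph_rel:
  assumes "pair_graph G"
  shows "finite (pverts G)" "parcs G \<subseteq> pverts G \<times> pverts G" "sym (parcs G)" "irrefl (parcs G)"
proof -
  interpret pair_graph G by fact
  show "finite (pverts G)" by (rule pair_finite_verts)
  show "parcs G \<subseteq> pverts G \<times> pverts G" using in_arcsD1 in_arcsD2 by auto
  show "sym (parcs G)" using pair_sym_arcs by (simp add: symmetric_def)
  show "irrefl (parcs G)" using pair_no_loops by (fastforce simp: irrefl_def)
qed

text \<open>Symmetric arcs turn connectivity into strong connectivity, and a set closed under
  neighbours absorbs everything reachable from one of its points.\<close>

lemma connected_imp_connected_rel:
  assumes G: "pair_graph G" and conn: "connected (with_proj G)"
  shows "pverts G \<noteq> {}" "connected_rel (pverts G) (parcs G)"
proof -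
  interpret pair_graph G by fact
  have sc: "strongly_connected (with_proj G)"
    using conn reachable_mk_symmetric_eq[OF sym_arcs] by (simp add: connected_def strongly_connected_def)
  then show "pverts G \<noteq> {}" by (simp add: strongly_connected_def)
  show "connected_rel (pverts G) (parcs G)"
    unfolding connected_rel_def
  proof (intro allI impI)
    fix P assume P: "P \<subseteq> pverts G" "P \<noteq> {}" "parcs G `` P \<subseteq> P"
    then obtain p where p: "p \<in> P" by auto
    have "v \<in> P" if "v \<in> pverts G" for v
    proof -
      have "p \<rightarrow>\<^sup>*\<^bsub>with_proj G\<^esub> v"
        using sc p P(1) that by (auto simp: strongly_connected_def)
      then show ?thesis using p P(3) by (induction rule: reachable_induct) auto
    qed
    then show "P = pverts G" using P(1) by auto
  qed
qed

lemma min_degree_attained: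
  assumes G: "pair_graph G" and ne: "pverts G \<noteq> {}"
  shows "\<And>v. v \<in> pverts G \<Longrightarrow> min_degree G \<le> card (parcs G `` {v})"
    and "\<exists>u\<in>pverts G. card (parcs G `` {u}) = min_degree G"
proof -
  have d: "out_degree (with_proj G) v = card (parcs G `` {v})" for v
  proof -
    have "out_arcs (with_proj G) v = Pair v ` (parcs G `` {v})" by (auto simp: out_arcs_def)
    then show ?thesis by (simp add: out_degree_def card_image inj_on_def)
  qed
  have fin: "finite (out_degree (with_proj G) ` pverts G)" using pair_graph_rel(1)[OF G] by simp
  show "min_degree G \<le> card (parcs G `` {v})" if "v \<in> pverts G" for v
    unfolding min_degree_def using fin that by (intro Min_le) (auto simp: d[symmetric])
  have "min_degree G \<in> out_degree (with_proj G) ` pverts G"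
    unfolding min_degree_def using fin ne by (intro Min_in) auto
  then show "\<exists>u\<in>pverts G. card (parcs G `` {u}) = min_degree G" by (auto simp: d)
qed

section \<open>Essential cuts as two-sided separations\<close>

text \<open>For symmetric \<open>E\<close> the sides are unions of components of what is left after
  deleting \<open>S\<close>. An edge inside a side amounts to a non-trivial component there.\<close>

definition splits :: "'a set \<Rightarrow> 'a rel \<Rightarrow> 'a set \<Rightarrow> 'a set \<Rightarrow> 'a set \<Rightarrow> bool" where
  "splits V E S A B \<longleftrightarrow> S \<subseteq> V \<and> A \<union> B = V - S \<and> A \<inter> B = {} \<and> E \<inter> A \<times> B = {} \<and>
     E \<inter> A \<times> A \<noteq> {} \<and> E \<inter> B \<times> B \<noteq> {}"

lemma induce_eq_mk_graph:
  "with_proj G \<restriction> U = with_proj (mk_graph U (parcs G \<inter> U \<times> U))"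
  by (auto simp: induce_subgraph_def mk_graph_def with_proj_def)

lemma pair_graph_induce:
  assumes "pair_graph G" "U \<subseteq> pverts G"
  shows "pair_graph (mk_graph U (parcs G \<inter> U \<times> U))"
proof -
  interpret pair_graph G by fact
  have "finite U" using assms(2) pair_finite_verts finite_subset by blast
  then show ?thesis
    using pair_graph_rel[OF assms(1)]
    by unfold_locales (auto simp: mk_graph_def symmetric_def sym_def irrefl_def)
qed

text \<open>In a strongly connected graph without arcs reachability collapses to equality, which
  leaves a single vertex.\<close>

lemma nontrivial_scc_edge:
  assumes G: "pair_graph G" and C: "C \<in> pre_digraph.sccs (with_proj G)" and nt: "\<not> trivial_graph C"
  shows "parcs G \<inter> verts C \<times> verts C \<noteq> {}"
proof -
  interpret pair_graph G by fact
  have ind: "induced_subgraph C (with_proj G)" and sc: "strongly_connected C"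
    using C by (auto simp: sccs_def)
  interpret C: wf_digraph C using ind by (simp add: induced_subgraph_def subgraph_def)
  have arcs: "arcs C = {e \<in> parcs G. fst e \<in> verts C \<and> snd e \<in> verts C}"
    using ind by (simp add: induced_subgraph_def)
  have "arcs C \<noteq> {}"
  proof
    assume empty: "arcs C = {}"
    have "p = q" if "p \<in> verts C" "q \<in> verts C" for p q
    proof -
      have "p \<rightarrow>\<^sup>*\<^bsub>C\<^esub> q" using sc that by (simp add: strongly_connected_def)
      then show ?thesis by (induction rule: C.reachable_induct) (auto simp: arcs_ends_def empty)
    qed
    moreover have "verts C \<noteq> {}" using sc by (simp add: strongly_connected_def)
    then obtain p where "p \<in> verts C" by blast
    ultimately have "verts C = {p}" by blast
    then have "card (verts C) = 1" by simp
    then show False using nt empty by (simp add: trivial_graph_def)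
  qed
  then show ?thesis using arcs by auto
qed

text \<open>One non-trivial component serves as \<open>A\<close> and everything else as
  \<open>B\<close>, which has an edge because it contains a second non-trivial component.\<close>

lemma essential_vertex_cut_imp_splits:
  assumes G: "pair_graph G" and cut: "essential_vertex_cut G S"
  obtains A B where "splits (pverts G) (parcs G) S A B"
proof -
  define U where "U = pverts G - S"
  define H where "H = mk_graph U (parcs G \<inter> U \<times> U)"
  have H: "pair_graph H" unfolding H_def by (rule pair_graph_induce[OF G]) (auto simp: U_def)
  interpret H: pair_graph H by fact
  have pH: "pverts H = U" by (simp add: H_def mk_graph_def)
  let ?N = "{C \<in> H.sccs. \<not> trivial_graph C}"
  have S: "S \<subseteq> pverts G" and card: "card ?N \<ge> 2"
    using cut by (auto simp: essential_vertex_cut_def induce_eq_mk_graph U_def H_def)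
  obtain C D where CD: "C \<in> ?N" "D \<in> ?N" "C \<noteq> D"
    using card card_2_iff' obtain_subset_with_card_n[OF card] by (smt (verit) subsetD)
  have disj: "verts C \<inter> verts D = {}" using CD by (intro H.scc_disj) auto
  have sub: "verts C \<subseteq> U" "verts D \<subseteq> U"
    using CD H.sccs_verts_subsets[of "verts C"] H.sccs_verts_subsets[of "verts D"] pH
    unfolding H.sccs_verts_conv by auto
  have sv: "verts C \<in> H.sccs_verts" using CD by (auto simp: H.sccs_verts_conv)
  have "splits (pverts G) (parcs G) S (verts C) (U - verts C)"
    unfolding splits_def
  proof (intro conjI)
    show "parcs G \<inter> verts C \<times> (U - verts C) = {}"
    proof (rule ccontr)
      assume "parcs G \<inter> verts C \<times> (U - verts C) \<noteq> {}"
      then obtain p q where pq: "(p, q) \<in> parcs G" "p \<in> verts C" "q \<in> U" "q \<notin> verts C" by auto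
      then have e: "(p, q) \<in> parcs H" "(q, p) \<in> parcs H"
        using sub pair_graph_rel(3)[OF G] by (auto simp: H_def mk_graph_def dest: symD)
      have "p \<rightarrow>\<^sup>*\<^bsub>with_proj H\<^esub> q" "q \<rightarrow>\<^sup>*\<^bsub>with_proj H\<^esub> p"
        using e by (simp_all add: H.reachable_adjI)
      then show False using sv pq by (auto simp: H.in_sccs_verts_conv_reachable)
    qed
    show "parcs G \<inter> verts C \<times> verts C \<noteq> {}"
      using nontrivial_scc_edge[OF H, of C] CD by (auto simp: H_def mk_graph_def)
    show "parcs G \<inter> (U - verts C) \<times> (U - verts C) \<noteq> {}"
      using nontrivial_scc_edge[OF H, of D] CD disj by (auto simp: H_def mk_graph_def)
  qed (use S sub in \<open>auto simp: U_def\<close>)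
  then show thesis by (rule that)
qed

text \<open>The components of an endpoint of an edge in \<open>A\<close> and of one in
  \<open>B\<close> are non-trivial; they differ because no path leaves \<open>A\<close>.\<close>

lemma splits_imp_essential_vertex_cut:
  assumes G: "pair_graph G" and sp: "splits (pverts G) (parcs G) S A B"
  shows "essential_vertex_cut G S"
proof -
  define U where "U = pverts G - S"
  define H where "H = mk_graph U (parcs G \<inter> U \<times> U)"
  have H: "pair_graph H" unfolding H_def by (rule pair_graph_induce[OF G]) (auto simp: U_def)
  interpret H: pair_graph H by fact
  have pH: "pverts H = U" by (simp add: H_def mk_graph_def)
  have AB: "A \<union> B = U" "A \<inter> B = {}" "S \<subseteq> pverts G" and noedge: "parcs G \<inter> A \<times> B = {}"
    using sp by (auto simp: splits_def U_def)
  obtain a a' b b' where e: "(a, a') \<in> parcs G" "a \<in> A" "a' \<in> A" "(b, b') \<in> parcs G" "b \<in> B" "b' \<in> B"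
    using sp unfolding splits_def by blast
  define comp where "comp v = with_proj H \<restriction> {w. v \<rightarrow>\<^sup>*\<^bsub>with_proj H\<^esub> w}" for v
  have scc: "comp v \<in> H.sccs" if "v \<in> U" for v
    unfolding comp_def by (rule H.induce_reachable_is_in_sccs) (use that in \<open>simp add: H_def mk_graph_def\<close>)
  have nt: "\<not> trivial_graph (comp v)" if "(v, w) \<in> parcs H" for v w
  proof -
    have "v \<rightarrow>\<^sup>*\<^bsub>with_proj H\<^esub> w" "v \<rightarrow>\<^sup>*\<^bsub>with_proj H\<^esub> v"
      using H.reachable_adjI[OF that] H.reachable_refl[OF H.in_arcsD1[OF that]] .
    then have "(v, w) \<in> arcs (comp v)" using that by (simp add: comp_def induce_subgraph_def)
    then show ?thesis by (auto simp: trivial_graph_def)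
  qed
  have AA: "w \<in> A" if "a \<rightarrow>\<^sup>*\<^bsub>with_proj H\<^esub> w" for w
    using that e(2)
  proof (induction rule: H.reachable_induct)
    case (step x y)
    then have "(x, y) \<in> parcs G" "y \<in> U" by (auto simp: H_def mk_graph_def)
    then show ?case using step noedge AB by auto
  qed auto
  have "b \<in> verts (comp b)" using H.reachable_refl[of b] e AB pH by (auto simp: comp_def)
  moreover have "b \<notin> verts (comp a)" using AA e AB by (auto simp: comp_def)
  ultimately have ne: "comp a \<noteq> comp b" by auto
  have "{comp a, comp b} \<subseteq> {C \<in> H.sccs. \<not> trivial_graph C}"
    using scc nt[of a a'] nt[of b b'] e AB by (auto simp: H_def mk_graph_def)
  \<comment> \<open>An infinite set has \<open>card\<close> 0, so the lower bound on the cardinality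
    depends on finiteness.\<close>
  moreover have "finite H.sccs"
    using H.finite_sccs_verts H.inj_on_verts_sccs by (simp add: H.sccs_verts_conv finite_image_iff)
  ultimately have "card {comp a, comp b} \<le> card {C \<in> H.sccs. \<not> trivial_graph C}"
    by (intro card_mono) auto
  then show ?thesis
    using ne AB(3) by (simp add: essential_vertex_cut_def induce_eq_mk_graph U_def H_def)
qed

lemma essential_connectivity_le:
  assumes "pair_graph G" "essential_vertex_cut G S"
  shows "essential_connectivity G \<le> card S"
proof -
  have "{S. essential_vertex_cut G S} \<subseteq> Pow (pverts G)" by (auto simp: essential_vertex_cut_def)
  then have "finite {S. essential_vertex_cut G S}"
    using pair_graph_rel(1)[OF assms(1)] by (meson finite_Pow_iff finite_subset)
  then show ?thesis unfolding essential_connectivity_def using assms(2) by (intro Min_le) auto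
qed

lemma essential_connectivity_attained:
  assumes "pair_graph G" "\<exists>S. essential_vertex_cut G S"
  obtains S where "essential_vertex_cut G S" "card S = essential_connectivity G"
proof -
  have "{S. essential_vertex_cut G S} \<subseteq> Pow (pverts G)" by (auto simp: essential_vertex_cut_def)
  then have "finite {S. essential_vertex_cut G S}"
    using pair_graph_rel(1)[OF assms(1)] by (meson finite_Pow_iff finite_subset)
  then have "essential_connectivity G \<in> card ` {S. essential_vertex_cut G S}"
    unfolding essential_connectivity_def using assms(2) by (intro Min_in) auto
  then show thesis using that by auto
qed

section \<open>The extremal graph and its quadratic form\<close>

text \<open>Bijections between equally large colour classes glue to one bijection. This produces
  isomorphisms between graphs whose adjacency is determined by vertex classes.\<close>

lemma bij_betw_colours:
  assumes fin: "finite V" "finite W"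
    and card: "\<And>i. card {v\<in>V. c v = i} = card {w\<in>W. d w = i}"
  obtains \<sigma> where "bij_betw \<sigma> V W" "\<And>v. v \<in> V \<Longrightarrow> d (\<sigma> v) = c v"
proof -
  have "\<forall>i. \<exists>g. bij_betw g {v\<in>V. c v = i} {w\<in>W. d w = i}"
    using card fin by (intro allI finite_same_card_bij) simp_all
  from choice[OF this] obtain g where g: "\<And>i. bij_betw (g i) {v\<in>V. c v = i} {w\<in>W. d w = i}"
    by blast
  define \<sigma> where "\<sigma> v = g (c v) v" for v
  have mem: "\<sigma> v \<in> W \<and> d (\<sigma> v) = c v" if "v \<in> V" for v
    using bij_betw_apply[OF g[of "c v"], of v] that by (auto simp: \<sigma>_def)
  have "inj_on \<sigma> V"
  proof (rule inj_onI)
    fix v w assume vw: "v \<in> V" "w \<in> V" "\<sigma> v = \<sigma> w"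
    then have "c v = c w" using mem[of v] mem[of w] by simp
    then show "v = w" using vw bij_betw_imp_inj_on[OF g[of "c v"]] by (auto simp: \<sigma>_def dest: inj_onD)
  qed
  moreover have "\<sigma> ` V = W"
  proof (intro equalityI subsetI)
    fix w assume "w \<in> W"
    then have "w \<in> g (d w) ` {v\<in>V. c v = d w}"
      using bij_betw_imp_surj_on[OF g[of "d w"]] by auto
    then obtain p where "p \<in> V" "c p = d w" "w = g (d w) p" by blast
    then show "w \<in> \<sigma> ` V" unfolding \<sigma>_def by (intro image_eqI[of _ _ p]) simp_all
  qed (use mem in auto)
  ultimately have "bij_betw \<sigma> V W" by (simp add: bij_betw_def)
  then show thesis by (rule that) (use mem in blast)
qed

text \<open>In the extremal graph of the case \<delta> \<le> \<kappa>, \<open>T\<close> is the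
  joined clique, \<open>v\<close> the vertex of K_1, \<open>u\<close> the attached vertex and
  \<open>N\<close> its \<delta> - 1 neighbours in \<open>T\<close>. Only \<open>u\<close> and
  \<open>v\<close> are restricted, which makes the missing pairs explicit.\<close>

definition pendant_rel :: "'a set \<Rightarrow> 'a \<Rightarrow> 'a \<Rightarrow> 'a set \<Rightarrow> 'a set \<Rightarrow> 'a rel" where
  "pendant_rel V u v T N = {(p, q). p \<in> V \<and> q \<in> V \<and> p \<noteq> q \<and>
     (p = v \<longrightarrow> q \<in> insert u T) \<and> (q = v \<longrightarrow> p \<in> insert u T) \<and>
     (p = u \<longrightarrow> q \<in> insert v N) \<and> (q = u \<longrightarrow> p \<in> insert v N)}"

text \<open>For disjoint \<open>A\<close> and \<open>B\<close> inside \<open>V\<close> this is the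
  join of the clique on the remaining vertices with two disjoint cliques on \<open>A\<close> and
  \<open>B\<close>.\<close>

definition two_clique_rel :: "'a set \<Rightarrow> 'a set \<Rightarrow> 'a set \<Rightarrow> 'a rel" where
  "two_clique_rel V A B = {(p, q). p \<in> V \<and> q \<in> V \<and> p \<noteq> q \<and>
     \<not> (p \<in> A \<and> q \<in> B) \<and> \<not> (p \<in> B \<and> q \<in> A)}"

lemma pendant_rel_simps:
  "pendant_rel V u v T N \<subseteq> V \<times> V" "sym (pendant_rel V u v T N)"
  by (auto simp: pendant_rel_def sym_def)

lemma two_clique_rel_simps:
  "two_clique_rel V A B \<subseteq> V \<times> V" "sym (two_clique_rel V A B)"
  by (auto simp: two_clique_rel_def sym_def)

locale pendant_config =
  fixes V :: "'a set" and u v :: 'a and T N :: "'a set"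
  assumes fin: "finite V" and uv: "u \<in> V" "v \<in> V" "u \<noteq> v"
    and T: "T \<subseteq> V - {u, v}" and N: "N \<subseteq> T"
begin

definition colour :: "'a \<Rightarrow> nat" where
  "colour p = (if p = u then 0 else if p = v then 1 else if p \<in> N then 2 else if p \<in> T then 3 else 4)"

lemma colour_iff:
  "colour p = 0 \<longleftrightarrow> p = u" "colour p = 1 \<longleftrightarrow> p = v" "colour p = 2 \<longleftrightarrow> p \<in> N"
  "colour p \<in> {2, 3} \<longleftrightarrow> p \<in> T"
  using uv T N by (auto simp: colour_def)

lemma card_colour:
  "card {p\<in>V. colour p = i} =
    [1, 1, card N, card T - card N, card V - 2 - card T, 0] ! min i 5"
proof -
  have diff: "card (T - N) = card T - card N" "card (V - {u, v} - T) = card V - 2 - card T"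
    using fin T N uv finite_subset[OF T] finite_subset[OF N] by (auto simp: card_Diff_subset)
  have classes: "{p\<in>V. colour p = 0} = {u}" "{p\<in>V. colour p = 1} = {v}" "{p\<in>V. colour p = 2} = N"
    "{p\<in>V. colour p = 3} = T - N" "{p\<in>V. colour p = 4} = V - {u, v} - T"
    using uv T N by (auto simp: colour_def split: if_splits)
  have empty: "{p\<in>V. colour p = i} = {}" if "i \<ge> 5" using that by (auto simp: colour_def)
  consider "i = 0" | "i = 1" | "i = 2" | "i = 3" | "i = 4" | "i \<ge> 5" by linarith
  then show ?thesis
    by cases (simp_all only: classes diff empty, simp_all add: min_def)
qed

end

text \<open>Adjacency is determined by the colours of two vertices and by whether they are equal, so
  a colour-preserving bijection is an isomorphism.\<close>

lemma pendant_rel_iso: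
  assumes "pendant_config V u v T N" "pendant_config W u' v' T' N'"
    and card: "card W = card V" "card T' = card T" "card N' = card N"
  obtains \<sigma> where "rel_iso \<sigma> V (pendant_rel V u v T N) W (pendant_rel W u' v' T' N')"
proof -
  interpret a: pendant_config V u v T N by fact
  interpret b: pendant_config W u' v' T' N' by fact
  have "card {p\<in>V. a.colour p = i} = card {p\<in>W. b.colour p = i}" for i
    unfolding a.card_colour b.card_colour card ..
  then obtain \<sigma> where \<sigma>: "bij_betw \<sigma> V W" "\<And>p. p \<in> V \<Longrightarrow> b.colour (\<sigma> p) = a.colour p"
    using bij_betw_colours[OF a.fin b.fin, of a.colour b.colour] by blast
  have [simp]: "\<sigma> p \<in> W" if "p \<in> V" for p
    using bij_betw_apply[OF \<sigma>(1) that] .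
  have [simp]: "\<sigma> p = u' \<longleftrightarrow> p = u" "\<sigma> p = v' \<longleftrightarrow> p = v" "\<sigma> p \<in> N' \<longleftrightarrow> p \<in> N"
    "\<sigma> p \<in> T' \<longleftrightarrow> p \<in> T" if "p \<in> V" for p
    unfolding a.colour_iff[symmetric] b.colour_iff[symmetric] \<sigma>(2)[OF that] by (rule refl)+
  have [simp]: "\<sigma> p = \<sigma> q \<longleftrightarrow> p = q" if "p \<in> V" "q \<in> V" for p q
    using \<sigma>(1) that by (auto simp: bij_betw_def dest: inj_onD)
  have "rel_iso \<sigma> V (pendant_rel V u v T N) W (pendant_rel W u' v' T' N')"
    using \<sigma>(1) by (simp add: rel_iso_def pendant_rel_def)
  then show thesis by (rule that)
qed

definition two_colour :: "'a set \<Rightarrow> 'a set \<Rightarrow> 'a \<Rightarrow> nat" where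
  "two_colour A B p = (if p \<in> A then 0 else if p \<in> B then 1 else 2)"

lemma card_two_colour:
  assumes "finite V" "A \<subseteq> V" "B \<subseteq> V" "A \<inter> B = {}"
  shows "card {p\<in>V. two_colour A B p = i} = [card A, card B, card V - (card A + card B), 0] ! min i 3"
proof -
  have diff: "card (V - (A \<union> B)) = card V - (card A + card B)"
    using assms finite_subset[OF assms(2)] finite_subset[OF assms(3)]
    by (simp add: card_Diff_subset card_Un_disjoint)
  have classes: "{p\<in>V. two_colour A B p = 0} = A" "{p\<in>V. two_colour A B p = 1} = B"
    "{p\<in>V. two_colour A B p = 2} = V - (A \<union> B)"
    using assms by (auto simp: two_colour_def split: if_splits)
  have empty: "{p\<in>V. two_colour A B p = i} = {}" if "i \<ge> 3" using that by (auto simp: two_colour_def)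
  consider "i = 0" | "i = 1" | "i = 2" | "i \<ge> 3" by linarith
  then show ?thesis
    by cases (simp_all only: classes diff empty, simp_all add: min_def)
qed

lemma two_clique_rel_iso:
  assumes fin: "finite V" "finite W" and A: "A \<subseteq> V" "A' \<subseteq> W" and B: "B \<subseteq> V" "B' \<subseteq> W"
    and disj: "A \<inter> B = {}" "A' \<inter> B' = {}"
    and card: "card W = card V" "card A' = card A" "card B' = card B"
  obtains \<sigma> where "rel_iso \<sigma> V (two_clique_rel V A B) W (two_clique_rel W A' B')"
proof -
  have "card {p\<in>V. two_colour A B p = i} = card {p\<in>W. two_colour A' B' p = i}" for i
    unfolding card_two_colour[OF fin(1) A(1) B(1) disj(1)] card_two_colour[OF fin(2) A(2) B(2) disj(2)] card ..
  then obtain \<sigma> where \<sigma>: "bij_betw \<sigma> V W" "\<And>p. p \<in> V \<Longrightarrow> two_colour A' B' (\<sigma> p) = two_colour A B p"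
    using bij_betw_colours[OF fin, of "two_colour A B" "two_colour A' B'"] by blast
  have [simp]: "(\<sigma> p \<in> A' \<longleftrightarrow> p \<in> A) \<and> (\<sigma> p \<in> B' \<longleftrightarrow> p \<in> B)" if "p \<in> V" for p
    using \<sigma>(2)[OF that] disj by (auto simp: two_colour_def split: if_splits)
  have [simp]: "\<sigma> p \<in> W" if "p \<in> V" for p using bij_betw_apply[OF \<sigma>(1) that] .
  have [simp]: "\<sigma> p = \<sigma> q \<longleftrightarrow> p = q" if "p \<in> V" "q \<in> V" for p q
    using \<sigma>(1) that by (auto simp: bij_betw_def dest: inj_onD)
  have "rel_iso \<sigma> V (two_clique_rel V A B) W (two_clique_rel W A' B')"
    using \<sigma>(1) by (simp add: rel_iso_def two_clique_rel_def)
  then show thesis by (rule that)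
qed

lemma extremal_graph_eq_pendant:
  assumes "1 \<le> \<delta>" "\<delta> \<le> \<kappa>" "\<kappa> + 2 \<le> n"
  shows "extremal_graph n \<kappa> \<delta> = mk_graph {0..<n} (pendant_rel {0..<n} (n - 1) \<kappa> {0..<\<kappa>} {0..<\<delta> - 1})"
proof -
  have c: "\<delta> - 1 < \<kappa>" using assms by linarith
  have V: "pverts (extremal_graph n \<kappa> \<delta>) = {0..<n}"
    using assms c
    by (auto simp: extremal_graph_def add_vertex_def graph_join_def graph_union_def complete_block_def)
  have "(p, q) \<in> parcs (extremal_graph n \<kappa> \<delta>) \<longleftrightarrow>
      (p, q) \<in> pendant_rel {0..<n} (n - 1) \<kappa> {0..<\<kappa>} {0..<\<delta> - 1}" for p q
  proof -
    \<comment> \<open>The blocks of labels are \<open>N\<close>, the rest of \<open>T\<close>,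
      \<open>v\<close>, the large clique, \<open>u\<close>, and the labels outside the graph;
      adjacency of distinct labels depends only on their blocks.\<close>
    have cases: "r < \<delta> - 1 \<or> \<delta> - 1 \<le> r \<and> r < \<kappa> \<or> r = \<kappa> \<or> \<kappa> < r \<and> r < n - 1 \<or> r = n - 1 \<or> n \<le> r" for r
      using assms by linarith
    show ?thesis
      using cases[of p] cases[of q] assms c
      by (elim disjE)
        (simp_all add: extremal_graph_def add_vertex_def graph_join_def graph_union_def complete_block_def
          pendant_rel_def, linarith+)
  qed
  then have "parcs (extremal_graph n \<kappa> \<delta>) = pendant_rel {0..<n} (n - 1) \<kappa> {0..<\<kappa>} {0..<\<delta> - 1}" by auto
  then show ?thesis using V by (metis mk_graph_collapse)
qed

lemma extremal_graph_eq_two_clique: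
  assumes "\<kappa> < \<delta>" "\<delta> + 1 \<le> n"
  shows "extremal_graph n \<kappa> \<delta> =
    mk_graph {0..<n} (two_clique_rel {0..<n} {\<kappa>..<\<kappa> + (n - \<delta> - 1)} {\<kappa> + (n - \<delta> - 1)..<n})"
proof -
  have c: "\<not> \<delta> - 1 < \<kappa>" using assms by linarith
  have V: "pverts (extremal_graph n \<kappa> \<delta>) = {0..<n}"
    using assms c
    by (auto simp: extremal_graph_def graph_join_def graph_union_def complete_block_def)
  have "(p, q) \<in> parcs (extremal_graph n \<kappa> \<delta>) \<longleftrightarrow>
      (p, q) \<in> two_clique_rel {0..<n} {\<kappa>..<\<kappa> + (n - \<delta> - 1)} {\<kappa> + (n - \<delta> - 1)..<n}" for p q
  proof -
    have cases: "r < \<kappa> \<or> \<kappa> \<le> r \<and> r < \<kappa> + (n - \<delta> - 1) \<or> \<kappa> + (n - \<delta> - 1) \<le> r \<and> r < n \<or> n \<le> r" for r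
      by linarith
    show ?thesis
      using cases[of p] cases[of q] assms c
      by (elim disjE)
        (simp_all add: extremal_graph_def graph_join_def graph_union_def complete_block_def
          two_clique_rel_def, linarith+)
  qed
  then have "parcs (extremal_graph n \<kappa> \<delta>) =
      two_clique_rel {0..<n} {\<kappa>..<\<kappa> + (n - \<delta> - 1)} {\<kappa> + (n - \<delta> - 1)..<n}" by auto
  then show ?thesis using V by (metis mk_graph_collapse)
qed

section \<open>Quadratic forms computed from the non-edges\<close>

lemma quad_Un:
  assumes "finite E" "finite F" "E \<inter> F = {}"
  shows "quad (E \<union> F) x = quad E x + quad F x"
  unfolding quad_def using assms by (rule sum.union_disjoint)

lemma quad_Times: "quad (A \<times> B) x = sum x A * sum x B"
  unfolding quad_def by (simp add: sum_product sum.cartesian_product)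

lemma quad_Id_on: "quad (Id_on V) x = (\<Sum>v\<in>V. (x v)\<^sup>2)"
proof -
  have "Id_on V = (\<lambda>v. (v, v)) ` V" by auto
  then show ?thesis
    unfolding quad_def by (simp add: sum.reindex inj_on_def power2_eq_square)
qed

text \<open>The full square contributes an amount independent of \<open>E\<close>, so a larger form
  means lighter missing pairs; for a loop-free relation these include the diagonal.\<close>

lemma quad_complement:
  assumes "finite V" "E \<subseteq> V \<times> V"
  shows "quad E x = (sum x V)\<^sup>2 - quad (V \<times> V - E) x"
proof -
  have "quad (V \<times> V) x = quad (E \<union> (V \<times> V - E)) x" using assms by (simp add: Un_absorb1)
  also have "\<dots> = quad E x + quad (V \<times> V - E) x"
    using assms finite_rel[OF assms] by (intro quad_Un) auto
  finally show ?thesis by (simp add: quad_Times power2_eq_square)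
qed

text \<open>One shape of missing pairs serves both sides of the comparison: the diagonal, a complete
  bipartite part and a star at \<open>u\<close>. Keeping \<open>u\<close> out of \<open>A\<close>
  and \<open>B\<close> prevents double counting.\<close>

lemma quad_nonedges:
  assumes fin: "finite V" and A: "A \<subseteq> V" and B: "B \<subseteq> V" and M: "M \<subseteq> V"
    and disj: "A \<inter> B = {}" "u \<notin> M" "u \<notin> A" "u \<notin> B"
  shows "quad (Id_on V \<union> (A \<times> B \<union> B \<times> A) \<union> ({u} \<times> M \<union> M \<times> {u})) x =
    (\<Sum>v\<in>V. (x v)\<^sup>2) + 2 * sum x A * sum x B + 2 * x u * sum x M"
proof -
  have fA: "finite A" and fB: "finite B" and fM: "finite M" using fin A B M finite_subset by blast+
  have "Id_on V \<subseteq> V \<times> V" by auto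
  then have fI: "finite (Id_on V)" by (rule finite_rel[OF fin])
  have AB: "quad (A \<times> B \<union> B \<times> A) x = 2 * sum x A * sum x B"
    using fA fB disj by (subst quad_Un) (auto simp: quad_Times)
  have M: "quad ({u} \<times> M \<union> M \<times> {u}) x = 2 * x u * sum x M"
    using fM disj by (subst quad_Un) (auto simp: quad_Times)
  have "quad (Id_on V \<union> (A \<times> B \<union> B \<times> A)) x = (\<Sum>v\<in>V. (x v)\<^sup>2) + 2 * sum x A * sum x B"
    using fI fA fB disj by (subst quad_Un) (auto simp: AB quad_Id_on)
  moreover have "(Id_on V \<union> (A \<times> B \<union> B \<times> A)) \<inter> ({u} \<times> M \<union> M \<times> {u}) = {}"
    using disj by auto
  ultimately show ?thesis
    using fI fA fB fM by (subst quad_Un) (simp_all add: M)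
qed

text \<open>Only missing pairs that are certain are subtracted; any further ones lower the form
  because \<open>x\<close> is nonnegative.\<close>

lemma quad_le_nonedges:
  assumes fin: "finite V" and E: "E \<subseteq> V \<times> V" "sym E" "irrefl E"
    and A: "A \<subseteq> V" and B: "B \<subseteq> V" and disj: "A \<inter> B = {}" "u \<notin> A" "u \<notin> B" and u: "u \<in> V"
    and AB: "E \<inter> A \<times> B = {}" and x: "\<And>v. v \<in> V \<Longrightarrow> x v \<ge> 0"
  shows "quad E x \<le> (sum x V)\<^sup>2 - (\<Sum>v\<in>V. (x v)\<^sup>2)
    - 2 * (sum x A * sum x B + x u * sum x (V - {u} - E `` {u}))"
proof -
  let ?M = "V - {u} - E `` {u}"
  let ?C = "Id_on V \<union> (A \<times> B \<union> B \<times> A) \<union> ({u} \<times> ?M \<union> ?M \<times> {u})"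
  have "?C \<subseteq> V \<times> V - E"
    using A B u AB E(2,3) by (auto simp: irrefl_def dest: symD)
  then have "quad ?C x \<le> quad (V \<times> V - E) x"
    unfolding quad_def case_prod_beta using fin x by (intro sum_mono2) auto
  moreover have "quad ?C x = (\<Sum>v\<in>V. (x v)\<^sup>2) + 2 * sum x A * sum x B + 2 * x u * sum x ?M"
    using disj by (intro quad_nonedges fin A B) auto
  ultimately show ?thesis unfolding quad_complement[OF fin E(1)] by (simp add: algebra_simps)
qed

lemma quad_pendant_rel:
  assumes "pendant_config V u v T N"
  shows "quad (pendant_rel V u v T N) x = (sum x V)\<^sup>2 - (\<Sum>v\<in>V. (x v)\<^sup>2)
    - 2 * (x v * sum x (V - {u, v} - T) + x u * sum x (V - {u, v} - N))"
proof -
  interpret pendant_config V u v T N by fact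
  \<comment> \<open>The bipartite part is \<open>{v}\<close> against \<open>?R\<close>, and the star
    joins \<open>u\<close> to \<open>?M\<close>.\<close>
  let ?R = "V - {u, v} - T" and ?M = "V - {u, v} - N"
  have "V \<times> V - pendant_rel V u v T N = Id_on V \<union> ({v} \<times> ?R \<union> ?R \<times> {v}) \<union> ({u} \<times> ?M \<union> ?M \<times> {u})"
  proof -
    have [simp]: "u \<notin> T" "v \<notin> T" "u \<notin> N" "v \<notin> N" "u \<in> V" "v \<in> V" "u \<noteq> v" "v \<noteq> u" using uv T N by auto
    have "(p, q) \<in> V \<times> V - pendant_rel V u v T N \<longleftrightarrow>
      (p, q) \<in> Id_on V \<union> ({v} \<times> ?R \<union> ?R \<times> {v}) \<union> ({u} \<times> ?M \<union> ?M \<times> {u})" for p q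
      by (cases "p = u"; cases "p = v"; cases "q = u"; cases "q = v") (auto simp: pendant_rel_def Id_on_iff)
    then show ?thesis unfolding Set.set_eq_iff split_paired_All by (rule allI[OF allI])
  qed
  moreover have "quad \<dots> x = (\<Sum>v\<in>V. (x v)\<^sup>2) + 2 * sum x {v} * sum x ?R + 2 * x u * sum x ?M"
    using uv by (intro quad_nonedges fin) auto
  ultimately show ?thesis
    unfolding quad_complement[OF fin pendant_rel_simps(1)] by (simp add: algebra_simps)
qed

lemma quad_two_clique_rel:
  assumes "finite V" "A \<subseteq> V" "B \<subseteq> V" "A \<inter> B = {}"
  shows "quad (two_clique_rel V A B) x = (sum x V)\<^sup>2 - (\<Sum>v\<in>V. (x v)\<^sup>2) - 2 * (sum x A * sum x B)"
proof -
  have fA: "finite A" and fB: "finite B" using assms finite_subset by blast+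
  have "Id_on V \<subseteq> V \<times> V" by auto
  then have fI: "finite (Id_on V)" by (rule finite_rel[OF assms(1)])
  have "V \<times> V - two_clique_rel V A B = Id_on V \<union> (A \<times> B \<union> B \<times> A)"
  proof -
    have "(p, q) \<in> V \<times> V - two_clique_rel V A B \<longleftrightarrow> (p, q) \<in> Id_on V \<union> (A \<times> B \<union> B \<times> A)" for p q
      using assms by (cases "p = q"; cases "p \<in> A"; cases "p \<in> B") (auto simp: two_clique_rel_def Id_on_iff)
    then show ?thesis unfolding Set.set_eq_iff split_paired_All by (rule allI[OF allI])
  qed
  moreover have "quad (A \<times> B \<union> B \<times> A) x = 2 * (sum x A * sum x B)"
    using fA fB assms(4) by (subst quad_Un) (auto simp: quad_Times)
  then have "quad (Id_on V \<union> (A \<times> B \<union> B \<times> A)) x = (\<Sum>v\<in>V. (x v)\<^sup>2) + 2 * (sum x A * sum x B)"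
    using fI fA fB assms(4) by (subst quad_Un) (auto simp: quad_Id_on)
  ultimately show ?thesis
    unfolding quad_complement[OF assms(1) two_clique_rel_simps(1)] by simp
qed

section \<open>Attaching the pendant pair to the heaviest vertices\<close>

definition heaviest :: "('a \<Rightarrow> real) \<Rightarrow> 'a set \<Rightarrow> 'a set \<Rightarrow> bool" where
  "heaviest x T W \<longleftrightarrow> T \<subseteq> W \<and> (\<forall>a\<in>T. \<forall>b\<in>W - T. x b \<le> x a)"

lemma heaviest_exists:
  assumes "finite W" "m \<le> card W"
  obtains T where "heaviest x T W" "card T = m"
proof -
  have "\<exists>T. heaviest x T W \<and> card T = m" using assms(2)
  proof (induction m)
    case 0
    show ?case by (intro exI[of _ "{}"]) (simp add: heaviest_def)
  next
    case (Suc m)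
    then have "m \<le> card W" by simp
    then obtain T where T: "heaviest x T W" "card T = m" using Suc.IH by blast
    then have TW: "T \<subseteq> W" "finite T" using assms(1) finite_subset by (auto simp: heaviest_def)
    then have "W - T \<noteq> {}" using T Suc.prems by auto
    then obtain c where c: "c \<in> W - T" "\<And>b. b \<in> W - T \<Longrightarrow> x b \<le> x c"
    proof -
      have fin: "finite (x ` (W - T))" using assms(1) by simp
      then have "Max (x ` (W - T)) \<in> x ` (W - T)" using \<open>W - T \<noteq> {}\<close> by (intro Max_in) auto
      then obtain c where "c \<in> W - T" "x c = Max (x ` (W - T))" by auto
      then show ?thesis by (intro that[of c]) (use Max_ge[OF fin] in simp_all)
    qed
    have "insert c T \<subseteq> W" using TW c(1) by simp
    moreover have "\<forall>a\<in>insert c T. \<forall>b\<in>W - insert c T. x b \<le> x a"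
    proof (intro ballI)
      fix a b assume "a \<in> insert c T" "b \<in> W - insert c T"
      then show "x b \<le> x a" using T(1) c(2)[of b] by (auto simp: heaviest_def)
    qed
    ultimately have "heaviest x (insert c T) W" by (simp add: heaviest_def)
    then show ?case using T TW c by (intro exI[of _ "insert c T"]) simp
  qed
  then show thesis using that by blast
qed

text \<open>Exchange argument: \<open>Z - T\<close> injects into \<open>T - Z\<close>, and no vertex
  outside \<open>T\<close> is heavier than one inside.\<close>

lemma sum_le_heaviest:
  assumes fin: "finite W" and T: "heaviest x T W" and Z: "Z \<subseteq> W" "card Z \<le> card T"
    and x: "\<And>w. w \<in> W \<Longrightarrow> x w \<ge> 0"
  shows "sum x Z \<le> sum x T"
proof -
  have f: "finite T" "finite Z" using T Z fin finite_subset by (auto simp: heaviest_def)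
  have "card (Z - T) \<le> card (T - Z)"
    using f Z(2) card_Diff_subset_Int[of Z T] card_Diff_subset_Int[of T Z] by (simp add: Int_commute)
  then obtain h where h: "h ` (Z - T) \<subseteq> T - Z" "inj_on h (Z - T)"
    using f card_le_inj[of "Z - T" "T - Z"] by auto
  have "sum x (Z - T) \<le> sum x (h ` (Z - T))"
    unfolding sum.reindex[OF h(2)] o_def
  proof (rule sum_mono)
    fix z assume z: "z \<in> Z - T"
    then have "h z \<in> T" "z \<in> W - T" using h(1) Z by auto
    then show "x z \<le> x (h z)" using T by (simp add: heaviest_def)
  qed
  also have "\<dots> \<le> sum x (T - Z)"
    using h(1) f T x by (intro sum_mono2) (auto simp: heaviest_def)
  finally have "sum x (Z - T) + sum x (Z \<inter> T) \<le> sum x (T - Z) + sum x (T \<inter> Z)"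
    by (simp add: Int_commute)
  then show ?thesis
    using sum.Int_Diff[OF f(2), of x T] sum.Int_Diff[OF f(1), of x Z] by simp
qed

lemma heaviest_pendant_config:
  fixes x :: "'a \<Rightarrow> real"
  assumes fin: "finite V" and u: "u \<in> V" "v \<in> V" "u \<noteq> v"
    and card: "k + 2 \<le> card V" "d \<le> k" and x: "\<And>w. w \<in> V \<Longrightarrow> x w \<ge> 0"
  obtains T N where "pendant_config V u v T N" "card T = k" "card N = d"
    "\<And>Z. Z \<subseteq> V - {u, v} \<Longrightarrow> card Z \<le> k \<Longrightarrow> sum x Z \<le> sum x T"
    "\<And>Z. Z \<subseteq> V - {u, v} \<Longrightarrow> card Z \<le> d \<Longrightarrow> sum x Z \<le> sum x N"
proof -
  let ?W = "V - {u, v}"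
  have cW: "card ?W = card V - 2" using fin u by (simp add: card_Diff_subset)
  obtain N where N: "heaviest x N ?W" "card N = d"
    by (rule heaviest_exists[of ?W d x]) (use fin cW card in auto)
  have NW: "N \<subseteq> ?W" "finite N" using N fin finite_subset[of N V] by (auto simp: heaviest_def)
  have "card (?W - N) = card V - 2 - d" using NW N cW by (simp add: card_Diff_subset)
  \<comment> \<open>Extending \<open>N\<close> by the heaviest remaining vertices keeps
    \<open>N\<close> inside \<open>T\<close> while \<open>T\<close> is also heaviest of its
    size.\<close>
  then obtain M where M: "heaviest x M (?W - N)" "card M = k - d"
    by - (rule heaviest_exists[of "?W - N" "k - d" x], use fin card in auto)
  have MW: "M \<subseteq> ?W - N" "finite M" using M fin finite_subset[of M V] by (auto simp: heaviest_def)
  have T: "heaviest x (N \<union> M) ?W" using N M by (auto simp: heaviest_def)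
  have "card (N \<union> M) = k" using NW MW N M card by (subst card_Un_disjoint) auto
  moreover have "pendant_config V u v (N \<union> M) N"
    using fin u NW MW by unfold_locales auto
  ultimately show thesis
    using that[of "N \<union> M" N] N sum_le_heaviest[OF _ T] sum_le_heaviest[OF _ N(1)] fin x by auto
qed

section \<open>Comparison with the extremal graph\<close>

text \<open>Used with \<open>k\<close> = \<kappa> and \<open>d\<close> = \<delta> - 1. The
  disjunction preserves the equality case: a proper spanning subgraph has strictly smaller radius as
  well, so only equality of relations leaves the radii equal.\<close>

definition pendant_bound :: "'a set \<Rightarrow> 'a rel \<Rightarrow> nat \<Rightarrow> nat \<Rightarrow> bool" where
  "pendant_bound V E k d \<longleftrightarrow> (\<exists>u v T N. pendant_config V u v T N \<and> card T = k \<and> card N = d \<and>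
     (E \<subseteq> pendant_rel V u v T N \<or>
      graph_spectral_radius (mk_graph V E) < graph_spectral_radius (mk_graph V (pendant_rel V u v T N))))"

locale graph_rel =
  fixes V :: "'a set" and E :: "'a rel"
  assumes fin: "finite V" and ne: "V \<noteq> {}" and EV: "E \<subseteq> V \<times> V"
    and sym: "sym E" and irr: "irrefl E" and conn: "connected_rel V E"
begin

lemma finN: "finite (E `` {v})"
  by (rule finite_Image_rel[OF fin EV])

definition perron_vec :: "('a \<Rightarrow> real) \<Rightarrow> bool" where
  "perron_vec x \<longleftrightarrow> (\<forall>v\<in>V. x v > 0) \<and>
     (\<forall>v\<in>V. sum x (E `` {v}) = graph_spectral_radius (mk_graph V E) * x v) \<and>
     quad E x = graph_spectral_radius (mk_graph V E) * (\<Sum>v\<in>V. (x v)\<^sup>2) \<and>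
     (\<Sum>v\<in>V. (x v)\<^sup>2) > 0"

lemma perron: obtains x where "perron_vec x"
  by (rule perron_vector[OF fin ne EV sym conn]) (auto simp: perron_vec_def intro: that)

lemma perron_vec_pos: "perron_vec x \<Longrightarrow> v \<in> V \<Longrightarrow> x v > 0"
  by (simp add: perron_vec_def)

text \<open>The last premise compares non-edge weights: those of a pendant graph with
  \<open>Z\<close> and \<open>Y\<close> as attachment sets against those certain to be missing in
  \<open>E\<close>. Heaviest sets only improve on \<open>Z\<close> and \<open>Y\<close>, so these
  may be chosen independently, without nesting. The pendant vertex \<open>u'\<close> may differ from
  the low-degree vertex \<open>u\<close>.\<close>

lemma pendant_boundI:
  assumes x: "perron_vec x"
    and A: "A \<subseteq> V" and B: "B \<subseteq> V" and disj: "A \<inter> B = {}" "u \<notin> A" "u \<notin> B" and u: "u \<in> V"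
    and AB: "E \<inter> A \<times> B = {}"
    and u': "u' \<in> V" and v: "v \<in> V" "u' \<noteq> v" and kd: "k + 2 \<le> card V" "d \<le> k"
    and Z: "Z \<subseteq> V - {u', v}" "card Z \<le> k" and Y: "Y \<subseteq> V - {u', v}" "card Y \<le> d"
    and less: "x v * (sum x V - x u' - x v - sum x Z) + x u' * (sum x V - x u' - x v - sum x Y)
      < sum x A * sum x B + x u * (sum x V - x u - sum x (E `` {u}))"
  shows "pendant_bound V E k d"
proof -
  have x0: "x v \<ge> 0" if "v \<in> V" for v using perron_vec_pos[OF x that] by simp
  obtain T N where c: "pendant_config V u' v T N" "card T = k" "card N = d"
    and ZT: "sum x Z \<le> sum x T" and YN: "sum x Y \<le> sum x N"
    by (rule heaviest_pendant_config[OF fin u' v kd, of x]) (use Z Y x0 in blast)+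
  interpret c: pendant_config V u' v T N by fact
  have s: "sum x (V - {u', v} - P) = sum x V - x u' - x v - sum x P" if "P \<subseteq> V - {u', v}" for P
  proof -
    have "sum x (V - {u', v} - P) = sum x (V - {u', v}) - sum x P"
      using fin that by (intro sum_diff) auto
    moreover have "sum x (V - {u', v}) = sum x V - sum x {u', v}"
      using fin u' v by (intro sum_diff) auto
    ultimately show ?thesis using v by simp
  qed
  have sM: "sum x (V - {u} - E `` {u}) = sum x V - x u - sum x (E `` {u})"
  proof -
    have "E `` {u} \<subseteq> V - {u}" using EV irr by (auto simp: irrefl_def)
    then have "sum x (V - {u} - E `` {u}) = sum x (V - {u}) - sum x (E `` {u})"
      using fin by (intro sum_diff) auto
    then show ?thesis using fin u by (simp add: sum_diff1)
  qed
  have "x v * sum x (V - {u', v} - T) \<le> x v * (sum x V - x u' - x v - sum x Z)"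
    unfolding s[OF c.T] using ZT x0[OF v(1)] by (intro mult_left_mono) auto
  moreover have "N \<subseteq> V - {u', v}" using c.N c.T by auto
  then have "x u' * sum x (V - {u', v} - N) \<le> x u' * (sum x V - x u' - x v - sum x Y)"
    unfolding s[OF \<open>N \<subseteq> V - {u', v}\<close>] using YN x0[OF u'] by (intro mult_left_mono) auto
  moreover have "quad E x \<le> (sum x V)\<^sup>2 - (\<Sum>v\<in>V. (x v)\<^sup>2)
    - 2 * (sum x A * sum x B + x u * sum x (V - {u} - E `` {u}))"
    by (rule quad_le_nonedges[OF fin EV sym irr A B disj u AB]) (rule x0)
  ultimately have "quad E x < quad (pendant_rel V u' v T N) x"
    using less unfolding quad_pendant_rel[OF c(1)] sM by argo
  then have "graph_spectral_radius (mk_graph V E) < graph_spectral_radius (mk_graph V (pendant_rel V u' v T N))"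
    using x unfolding perron_vec_def by (intro spectral_radius_less[OF fin ne pendant_rel_simps, of E x]) simp_all
  then show ?thesis using c unfolding pendant_bound_def by blast
qed

end

section \<open>Low-degree vertex in the cut or with a neighbour on its own side\<close>

locale split_graph = graph_rel V E for V :: "'a set" and E +
  fixes S A B
  assumes SV: "S \<subseteq> V" and AB: "A \<union> B = V - S" "A \<inter> B = {}" and noedge: "E \<inter> A \<times> B = {}"
begin

lemma swap: "split_graph V E S B A"
proof
  show "E \<inter> B \<times> A = {}" using noedge sym by (auto dest: symD)
qed (use SV AB in auto)

lemma subV: "A \<subseteq> V" "B \<subseteq> V" using AB by auto

lemma fins: "finite S" "finite A" "finite B"
  using fin SV subV finite_subset by blast+

lemma sumV: "sum f V = sum f S + sum f A + sum f B" for f :: "'a \<Rightarrow> real"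
proof -
  have "V = S \<union> (A \<union> B)" using SV AB by auto
  moreover have "S \<inter> (A \<union> B) = {}" using AB by auto
  ultimately show ?thesis using fins AB(2) by (simp add: sum.union_disjoint)
qed

text \<open>The pendant pair is \<open>u\<close>, \<open>v\<close>. The star at \<open>u\<close> has
  the same missing weight in both graphs, so only the weight at \<open>v\<close> has to be compared
  with the product of the weights of \<open>A\<close> and \<open>B\<close>.\<close>

lemma pendant_bound_in_cut_aux:
  assumes u: "u \<in> S" and card: "card S = k" "card (E `` {u}) = Suc d" "d < k" "k + 2 \<le> card V"
    and v: "(u, v) \<in> E" "v \<in> A" and w: "w \<in> B"
    and x: "perron_vec x" and vw: "x v \<le> x w"
  shows "pendant_bound V E k d"
proof (rule pendant_boundI[OF x subV AB(2)])
  have disjS: "v \<notin> S" "w \<notin> S" "u \<noteq> v" "v \<noteq> w" using u v w AB by auto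
  show "u \<notin> A" "u \<notin> B" "u \<in> V" "E \<inter> A \<times> B = {}" "u \<in> V" "v \<in> V" "u \<noteq> v" "k + 2 \<le> card V" "d \<le> k"
    using u v AB SV noedge card by auto
  \<comment> \<open>Since \<open>u\<close> belongs to the pair it leaves the clique, and
    \<open>w\<close> takes its place to restore the size \<open>k\<close>.\<close>
  show "insert w (S - {u}) \<subseteq> V - {u, v}" using SV AB u v w by auto
  show "card (insert w (S - {u})) \<le> k"
    using fins card u disjS by (simp add: card_Diff_singleton card_gt_0_iff)
  show "E `` {u} - {v} \<subseteq> V - {u, v}" using EV irr by (auto simp: irrefl_def)
  show "card (E `` {u} - {v}) \<le> d" using finN card v by (simp add: card_Diff_singleton)
  have sY: "sum x (E `` {u} - {v}) = sum x (E `` {u}) - x v" using finN v by (simp add: sum_diff1)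
  have sZ: "sum x (insert w (S - {u})) = x w + sum x S - x u"
    using fins u disjS by (simp add: sum_diff1)
  have a: "x v \<le> sum x A"
    using fins v subV perron_vec_pos[OF x] by (intro member_le_sum) (auto intro: less_imp_le)
  have b: "x w \<le> sum x B"
    using fins w subV perron_vec_pos[OF x] by (intro member_le_sum) (auto intro: less_imp_le)
  have "0 \<le> (sum x A - x v) * (sum x B - x v)" using a b vw by simp
  moreover have "0 < x v * x w" using perron_vec_pos[OF x] v w subV by (intro mult_pos_pos) auto
  ultimately show "x v * (sum x V - x u - x v - sum x (insert w (S - {u}))) +
      x u * (sum x V - x u - x v - sum x (E `` {u} - {v}))
      < sum x A * sum x B + x u * (sum x V - x u - sum x (E `` {u}))"
    unfolding sumV sY sZ by (simp add: algebra_simps)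
qed

lemma pendant_bound_in_cut:
  assumes u: "u \<in> S" and card: "card S = k" "card (E `` {u}) = Suc d" "d < k" "k + 2 \<le> card V"
    and v: "(u, v) \<in> E" "v \<in> A" and w: "(u, w) \<in> E" "w \<in> B"
  shows "pendant_bound V E k d"
proof -
  interpret s: split_graph V E S B A by (rule swap)
  obtain x where x: "perron_vec x"
    by (rule perron)
  show ?thesis
  proof (cases "x v \<le> x w")
    case True
    then show ?thesis by (rule pendant_bound_in_cut_aux[OF u card v w(2) x])
  next
    case False
    then have "x w \<le> x v" by simp
    then show ?thesis by (rule s.pendant_bound_in_cut_aux[OF u card w v(2) x])
  qed
qed

text \<open>If \<open>A\<close> is just the pair \<open>u\<close>, \<open>v\<close>, the graph
  already lies inside a pendant graph. Otherwise the pair is chosen by comparing \<open>x v\<close>,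
  the weight of \<open>B\<close> and \<open>x u\<close>.\<close>

lemma pendant_bound_in_component:
  assumes u: "u \<in> A" and card: "card S = k" "card (E `` {u}) = Suc d" "d \<le> k" "k + 2 \<le> card V"
    and v: "(u, v) \<in> E" "v \<in> A" and B2: "card B \<ge> 2"
  shows "pendant_bound V E k d"
proof (cases "A = {u, v}")
  case True
  have uv: "u \<noteq> v" using v irr by (auto simp: irrefl_def)
  have NuS: "E `` {u} - {v} \<subseteq> S" using EV irr AB noedge True by (auto simp: irrefl_def)
  have "pendant_config V u v S (E `` {u} - {v})"
    using fin u v subV uv SV AB NuS by unfold_locales auto
  moreover have "card (E `` {u} - {v}) = d" using finN card v by (simp add: card_Diff_singleton)
  moreover have "E \<subseteq> pendant_rel V u v S (E `` {u} - {v})"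
  proof clarify
    fix p q assume e: "(p, q) \<in> E"
    then have e': "(q, p) \<in> E" "p \<noteq> q" "p \<in> V" "q \<in> V" using sym irr EV by (auto simp: irrefl_def dest: symD)
    have vS: "r \<in> insert u S" if "(v, r) \<in> E" for r
    proof -
      have "r \<in> V" "r \<noteq> v" "r \<notin> B" using that EV irr noedge v(2) by (auto simp: irrefl_def)
      then show ?thesis using AB True by auto
    qed
    then show "(p, q) \<in> pendant_rel V u v S (E `` {u} - {v})"
      using e e' vS[of p] vS[of q] by (auto simp: pendant_rel_def)
  qed
  ultimately show ?thesis using card unfolding pendant_bound_def by blast
next
  case A3: False
  have uv: "u \<noteq> v" using v irr by (auto simp: irrefl_def)
  obtain x where x: "perron_vec x"
    by (rule perron)
  \<comment> \<open>The missing pairs between \<open>u\<close> and \<open>B\<close> are counted in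
    the star at \<open>u\<close>, so \<open>u\<close> is taken out of \<open>A\<close>.\<close>
  define A' where "A' = A - {u}"
  define a b \<nu> where "a = sum x A'" and "b = sum x B" and "\<nu> = sum x (E `` {u})"
  have sA: "sum x A = a + x u" using fins u by (simp add: a_def A'_def sum_diff1)
  have sV: "sum x V = sum x S + a + x u + b" by (simp add: sumV sA b_def)
  have Nu: "E `` {u} \<subseteq> S \<union> A'" using EV irr AB noedge u by (auto simp: irrefl_def A'_def)
  have \<nu>: "\<nu> \<le> sum x S + a"
  proof -
    have "\<nu> \<le> sum x (S \<union> A')" unfolding \<nu>_def
      using Nu fins SV subV less_imp_le[OF perron_vec_pos[OF x]] by (intro sum_mono2) (auto simp: A'_def)
    also have "\<dots> = sum x S + a" unfolding a_def
      using fins AB by (intro sum.union_disjoint) (auto simp: A'_def)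
    finally show ?thesis .
  qed
  \<comment> \<open>A third vertex of \<open>A\<close> makes this strict, and all three choices
    below draw on this strictness.\<close>
  have av: "x v < a"
  proof -
    obtain z where z: "z \<in> A" "z \<noteq> u" "z \<noteq> v" using A3 u v(2) by auto
    have "x v < x v + x z" using perron_vec_pos[OF x] z subV by auto
    also have "\<dots> = sum x {v, z}" using z by simp
    also have "\<dots> \<le> a" unfolding a_def
      using fins z v uv subV perron_vec_pos[OF x] by (intro sum_mono2) (auto simp: A'_def intro: less_imp_le)
    finally show ?thesis .
  qed
  have Vs: "v \<in> V" "E `` {u} - {v} \<subseteq> V - {u, v}" using EV irr v(1) by (auto simp: irrefl_def)
  have sY: "sum x (E `` {u} - {v}) = \<nu> - x v" using finN v by (simp add: sum_diff1 \<nu>_def)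
  have cY: "card (E `` {u} - {v}) \<le> d" using finN card v by (simp add: card_Diff_singleton)
  have A'V: "A' \<subseteq> V" "A' \<inter> B = {}" "u \<notin> A'" "u \<notin> B" "u \<in> V" "E \<inter> A' \<times> B = {}"
    using subV AB u noedge by (auto simp: A'_def)
  note I = pendant_boundI[OF x A'V(1) subV(2) A'V(2-6)]
  note pos = perron_vec_pos[OF x]
  have xu: "x u > 0" and xv: "x v > 0" using pos u v subV by auto
  have xB: "x w > 0" "w \<in> V" "w \<notin> S" "w \<notin> A'" "w \<noteq> u" "x w \<le> b" if "w \<in> B" for w
  proof -
    show "x w \<le> b" unfolding b_def using fins that subV perron_vec_pos[OF x] by (intro member_le_sum) (auto intro: less_imp_le)
  qed (use that pos subV AB u in \<open>auto simp: A'_def\<close>)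
  have xB2: "x w + x z \<le> b" if "w \<in> B" "z \<in> B" "w \<noteq> z" for w z
  proof -
    have "sum x {w, z} \<le> b" unfolding b_def
      using fins that subV perron_vec_pos[OF x] by (intro sum_mono2) (auto intro: less_imp_le)
    then show ?thesis using that by simp
  qed
  \<comment> \<open>The pair is \<open>u\<close>, \<open>v\<close> in the first case,
    \<open>u\<close> and a vertex of \<open>B\<close> in the second, and two vertices of
    \<open>B\<close> in the third.\<close>
  consider "x v < b" | w where "w \<in> B" "b \<le> x v" "x u \<le> b - x w"
    | "b \<le> x v" "\<And>w. w \<in> B \<Longrightarrow> b - x w < x u" by force
  then show ?thesis
  proof cases
    case 1
    show ?thesis
    proof (rule I[of u v k d S "E `` {u} - {v}"])
      \<comment> \<open>This product is exactly the gain.\<close>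
      have "0 < (a - x v) * (b - x v)" using av 1 by simp
      then show "x v * (sum x V - x u - x v - sum x S) +
          x u * (sum x V - x u - x v - sum x (E `` {u} - {v}))
          < sum x A' * sum x B + x u * (sum x V - x u - sum x (E `` {u}))"
        unfolding sV sY by (simp add: algebra_simps flip: a_def b_def \<nu>_def)
      show "S \<subseteq> V - {u, v}" using SV AB u v(2) by blast
    qed (use A'V(5) Vs uv card cY in simp_all)
  next
    case (2 w)
    show ?thesis
    proof (rule I[of u w k d S "E `` {u} - {v}"])
      \<comment> \<open>The gain is \<open>(a - x w) * (b - x w) - x u * (x v - x w)\<close>: the
        set \<open>Y\<close> gives up \<open>v\<close> although the new partner is the lighter
        \<open>w\<close>.\<close>
      have "x u * (x v - x w) \<le> (b - x w) * (x v - x w)"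
        using 2 xB[of w] by (intro mult_right_mono) auto
      also have "\<dots> < (b - x w) * (a - x w)" using av 2 xu by (intro mult_strict_left_mono) auto
      finally show "x w * (sum x V - x u - x w - sum x S) +
          x u * (sum x V - x u - x w - sum x (E `` {u} - {v}))
          < sum x A' * sum x B + x u * (sum x V - x u - sum x (E `` {u}))"
        unfolding sV sY by (simp add: algebra_simps flip: a_def b_def \<nu>_def)
      show "S \<subseteq> V - {u, w}" "E `` {u} - {v} \<subseteq> V - {u, w}"
        using Vs SV xB(3,4)[OF 2(1)] Nu AB u by blast+
      show "u \<noteq> w" using xB(5)[OF 2(1)] by simp
    qed (use A'V(5) xB(2)[OF 2(1)] card cY in simp_all)
  next
    case 3
    obtain w z where wz: "w \<in> B" "z \<in> B" "w \<noteq> z" using B2 by (auto simp: numeral_2_eq_2 card_le_Suc_iff)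
    have wu: "x w < x u" using 3(2)[OF wz(2)] xB2[OF wz] by linarith
    show ?thesis
    proof (rule I[of w z k d S "E `` {u} - {v}"])
      \<comment> \<open>The gain is the sum of this term and the two nonnegative products that
        follow.\<close>
      have "0 < x w * (a - x v)" using xB(1)[OF wz(1)] av by simp
      moreover have "0 \<le> (b - x w - x z) * (a + x u - x z - x w)"
        using xB2[OF wz] av 3(1) xu by (intro mult_nonneg_nonneg) linarith+
      moreover have "0 \<le> (sum x S + a - \<nu>) * (x u - x w)" using \<nu> wu by simp
      ultimately show "x z * (sum x V - x w - x z - sum x S) +
          x w * (sum x V - x w - x z - sum x (E `` {u} - {v}))
          < sum x A' * sum x B + x u * (sum x V - x u - sum x (E `` {u}))"
        unfolding sV sY by (simp add: algebra_simps flip: a_def b_def \<nu>_def)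
      show "S \<subseteq> V - {w, z}" "E `` {u} - {v} \<subseteq> V - {w, z}"
        using Vs SV xB(3,4)[OF wz(1)] xB(3,4)[OF wz(2)] Nu by blast+
    qed (use xB(2)[OF wz(1)] xB(2)[OF wz(2)] wz(3) card cY in simp_all)
  qed
qed

end

section \<open>Low-degree vertex with all its neighbours in the cut\<close>

lemma graph_spectral_radius_mono:
  assumes "graph_rel V E" "graph_rel V F" "E \<subseteq> F"
  shows "graph_spectral_radius (mk_graph V E) \<le> graph_spectral_radius (mk_graph V F)"
proof (cases "E = F")
  case False
  interpret e: graph_rel V E by fact
  interpret f: graph_rel V F by fact
  show ?thesis
    using False assms(3)
    by (intro less_imp_le spectral_radius_strict_mono[OF e.fin e.ne e.sym e.conn f.EV f.sym]) auto
qed simp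

text \<open>Allows a larger graph to be treated instead, whose regular structure gives usable
  eigenvalue equations.\<close>

lemma pendant_bound_mono:
  assumes "graph_rel V E" "graph_rel V F" "E \<subseteq> F" "pendant_bound V F k d"
  shows "pendant_bound V E k d"
proof -
  obtain u v T N where c: "pendant_config V u v T N" "card T = k" "card N = d"
    and "F \<subseteq> pendant_rel V u v T N \<or>
      graph_spectral_radius (mk_graph V F) < graph_spectral_radius (mk_graph V (pendant_rel V u v T N))"
    using assms(4) unfolding pendant_bound_def by blast
  then have "E \<subseteq> pendant_rel V u v T N \<or>
      graph_spectral_radius (mk_graph V E) < graph_spectral_radius (mk_graph V (pendant_rel V u v T N))"
    using graph_spectral_radius_mono[OF assms(1-3)] assms(3) by auto
  then show ?thesis using c unfolding pendant_bound_def by blast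
qed

text \<open>The largest graph in which \<open>S\<close> separates \<open>A\<close>, \<open>B\<close> and the single vertex \<open>u\<close>.\<close>

definition isolated_rel :: "'a set \<Rightarrow> 'a \<Rightarrow> 'a set \<Rightarrow> 'a set \<Rightarrow> 'a set \<Rightarrow> 'a rel" where
  "isolated_rel V u N A B = {(p, q). p \<in> V \<and> q \<in> V \<and> p \<noteq> q \<and>
     \<not> (p \<in> A \<and> q \<in> B) \<and> \<not> (p \<in> B \<and> q \<in> A) \<and> (p = u \<longrightarrow> q \<in> N) \<and> (q = u \<longrightarrow> p \<in> N)}"

lemma isolated_rel_swap: "isolated_rel V u N A B = isolated_rel V u N B A"
  by (auto simp: isolated_rel_def)

text \<open>The Perron vector is constant on \<open>A\<close> and on \<open>B\<close>, so its
  entries can be compared through the eigenvalue equations. The pair consists of \<open>u\<close>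
  and a vertex \<open>w\<close> of the smaller side, and \<open>u\<close> gives up one neighbour
  \<open>s\<close>.\<close>

lemma pendant_bound_isolated_aux:
  assumes g: "graph_rel V (isolated_rel V u N A B)"
    and part: "V = S \<union> {u} \<union> A \<union> B" "u \<notin> S" "u \<notin> A" "u \<notin> B" "S \<inter> A = {}" "S \<inter> B = {}" "A \<inter> B = {}"
    and N: "N \<subseteq> S" and card: "card S = k" "card N = Suc d" "d \<le> k" "k + 2 \<le> card V"
    and AB: "card B \<le> card A" "2 \<le> card B"
  shows "pendant_bound V (isolated_rel V u N A B) k d"
proof -
  interpret graph_rel V "isolated_rel V u N A B" by fact
  let ?E = "isolated_rel V u N A B"
  obtain x where x: "perron_vec x" by (rule perron)
  note pos = perron_vec_pos[OF x]
  \<comment> \<open>The shift by 1 adds each vertex to its own neighbourhood, so the equation has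
    the same right side at all vertices of \<open>A\<close>, and likewise of
    \<open>B\<close>.\<close>
  define L where "L = graph_spectral_radius (mk_graph V ?E) + 1"
  define a b \<sigma> \<nu> where "a = sum x A" and "b = sum x B" and "\<sigma> = sum x S" and "\<nu> = sum x N"
  have fins: "finite S" "finite A" "finite B" "finite N"
  proof -
    have "S \<subseteq> V" "A \<subseteq> V" "B \<subseteq> V" "N \<subseteq> V" using part(1) N by blast+
    then show "finite S" "finite A" "finite B" "finite N" using fin finite_subset by blast+
  qed
  have sV: "sum x V = \<sigma> + x u + a + b"
  proof -
    have "sum x V = sum x (S \<union> {u} \<union> A) + sum x B"
      unfolding part(1) using fins part(4,6,7) by (intro sum.union_disjoint) auto
    also have "sum x (S \<union> {u} \<union> A) = sum x (S \<union> {u}) + sum x A"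
      using fins part(3,5) by (intro sum.union_disjoint) auto
    finally show ?thesis using fins part(2) by (simp add: a_def b_def \<sigma>_def)
  qed
  have eig: "L * x v = sum x (?E `` {v}) + x v" if "v \<in> V" for v
    using x that by (simp add: perron_vec_def L_def algebra_simps)
  have Nu: "?E `` {u} = N" using part N by (auto simp: isolated_rel_def)
  have EA: "L * x p = \<sigma> + a" if "p \<in> A" for p
  proof -
    have "?E `` {p} = S \<union> (A - {p})" using that part N by (auto simp: isolated_rel_def)
    moreover have "sum x (S \<union> (A - {p})) = \<sigma> + (a - x p)"
      unfolding a_def \<sigma>_def using fins part that by (subst sum.union_disjoint) (auto simp: sum_diff1)
    ultimately show ?thesis using eig[of p] that part by simp
  qed
  have EB: "L * x p = \<sigma> + b" if "p \<in> B" for p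
  proof -
    have "?E `` {p} = S \<union> (B - {p})" using that part N by (auto simp: isolated_rel_def)
    moreover have "sum x (S \<union> (B - {p})) = \<sigma> + (b - x p)"
      unfolding b_def \<sigma>_def using fins part that by (subst sum.union_disjoint) (auto simp: sum_diff1)
    ultimately show ?thesis using eig[of p] that part by simp
  qed
  \<comment> \<open>A vertex of \<open>N\<close> is adjacent to all others, so
    \<open>L * x s\<close> is the total weight.\<close>
  obtain s where s: "s \<in> N" using card(2) by fastforce
  have Es: "L * x s = \<sigma> + x u + a + b"
  proof -
    have "s \<in> V" using s N part(1) by auto
    have "?E `` {s} = V - {s}" using s part N by (auto simp: isolated_rel_def)
    then show ?thesis using eig[OF \<open>s \<in> V\<close>] \<open>s \<in> V\<close> fin by (simp add: sum_diff1 sV)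
  qed
  have "u \<in> V" using part(1) by blast
  then have Eu: "L * x u = \<nu> + x u" using eig[of u] unfolding Nu \<nu>_def by simp
  obtain p where p: "p \<in> A" using AB by fastforce
  obtain w where w: "w \<in> B" using AB by fastforce
  have V: "p \<in> V" "w \<in> V" "s \<in> V" "u \<in> V" "A \<subseteq> V" "B \<subseteq> V" "S \<subseteq> V" using p w s N part(1) by auto
  note xp = pos[OF V(1)] pos[OF V(2)] pos[OF V(3)] pos[OF V(4)]
  have \<sigma>s: "x s \<le> \<sigma>" unfolding \<sigma>_def
    using fins s N V(7) by (intro member_le_sum) (auto intro!: less_imp_le[OF pos])
  have "a > 0" unfolding a_def using fins p V(5) pos by (intro sum_pos) auto
  have "b > 0" unfolding b_def using fins w V(6) pos by (intro sum_pos) auto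
  have L0: "L > 0"
  proof (rule ccontr)
    assume "\<not> L > 0"
    then have "L * x p \<le> 0" using xp by (simp add: mult_nonpos_nonneg)
    then show False using EA[OF p] \<sigma>s xp \<open>a > 0\<close> by simp
  qed
  define \<alpha> \<beta> where "\<alpha> = x p" and "\<beta> = x w"
  have "x q = \<alpha>" if "q \<in> A" for q
  proof -
    have "L * x q = L * \<alpha>" using EA[OF that] EA[OF p] by (simp add: \<alpha>_def)
    then show ?thesis using L0 by simp
  qed
  then have a: "a = real (card A) * \<alpha>" by (simp add: a_def)
  have "x q = \<beta>" if "q \<in> B" for q
  proof -
    have "L * x q = L * \<beta>" using EB[OF that] EB[OF w] by (simp add: \<beta>_def)
    then show ?thesis using L0 by simp
  qed
  then have b: "b = real (card B) * \<beta>" by (simp add: b_def)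
  have A: "L * \<alpha> = \<sigma> + a" and B: "L * \<beta> = \<sigma> + b" using EA[OF p] EB[OF w] by (simp_all add: \<alpha>_def \<beta>_def)
  have "\<alpha> > 0" "\<beta> > 0" using xp by (simp_all add: \<alpha>_def \<beta>_def)
  have "L * \<alpha> \<le> L * x s" using A Es xp \<open>b > 0\<close> by simp
  then have "\<alpha> \<le> x s" using L0 by simp
  \<comment> \<open>The cut weighs at least \<open>x s\<close>, hence at least one more
    \<open>\<alpha>\<close> beyond the \<open>card A\<close> copies in \<open>a\<close>.\<close>
  have "(real (card A) + 1) * \<alpha> \<le> L * \<alpha>"
    using A \<sigma>s \<open>\<alpha> \<le> x s\<close> a by (simp add: algebra_simps)
  then have L: "real (card A) + 1 \<le> L" using \<open>\<alpha> > 0\<close> by simp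
  have cAB: "real (card B) \<le> real (card A)" "2 \<le> real (card B)" using AB by simp_all
  \<comment> \<open>Both \<open>(L - card A) * \<alpha>\<close> and
    \<open>(L - card B) * \<beta>\<close> equal \<open>\<sigma>\<close>.\<close>
  have "\<beta> \<le> \<alpha>"
  proof -
    have "(L - real (card A)) * \<beta> \<le> (L - real (card B)) * \<beta>"
      using cAB \<open>\<beta> > 0\<close> by (intro mult_right_mono) auto
    also have "\<dots> = (L - real (card A)) * \<alpha>" using A B a b by (simp add: algebra_simps)
    finally show ?thesis using L by simp
  qed
  have "x u < \<beta>"
  proof -
    have "\<nu> \<le> \<sigma>" unfolding \<nu>_def \<sigma>_def
      using fins N V(7) by (intro sum_mono2) (auto intro!: less_imp_le[OF pos])
    then have "(L - 1) * x u \<le> (L - real (card B)) * \<beta>" using Eu B b by (simp add: algebra_simps)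
    also have "\<dots> < (L - 1) * \<beta>" using cAB \<open>\<beta> > 0\<close> by (intro mult_strict_right_mono) auto
    finally show ?thesis using L cAB by (auto simp: mult_less_cancel_left)
  qed
  \<comment> \<open>After cancellation the comparison of non-edges is exactly this: replacing the
    neighbour \<open>s\<close> by \<open>w\<close> must cost less than the gain between the
    sides.\<close>
  have main: "x u * (x s - \<beta>) < (a - \<beta>) * (b - \<beta>)"
  proof -
    have "L * (x s - \<beta>) = a + x u" using Es B by (simp add: algebra_simps)
    also have "\<dots> < (real (card A) + 1) * \<alpha>" using a \<open>x u < \<beta>\<close> \<open>\<beta> \<le> \<alpha>\<close> by (simp add: algebra_simps)
    also have "\<dots> \<le> L * \<alpha>" using L \<open>\<alpha> > 0\<close> by simp
    finally have "x s - \<beta> < \<alpha>" using L0 by simp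
    moreover have "0 \<le> x s - \<beta>" using \<open>\<alpha> \<le> x s\<close> \<open>\<beta> \<le> \<alpha>\<close> by simp
    ultimately have "x u * (x s - \<beta>) < \<beta> * \<alpha>"
      using \<open>x u < \<beta>\<close> xp \<open>\<beta> > 0\<close> by (intro mult_strict_mono) auto
    also have "\<dots> \<le> (b - \<beta>) * (a - \<beta>)"
    proof (intro mult_mono)
      have "2 * \<beta> \<le> b" using b cAB \<open>\<beta> > 0\<close> by simp
      then show "\<beta> \<le> b - \<beta>" "0 \<le> b - \<beta>" using \<open>\<beta> > 0\<close> by simp_all
      have "2 * \<alpha> \<le> a" using a cAB \<open>\<alpha> > 0\<close> by simp
      then show "\<alpha> \<le> a - \<beta>" using \<open>\<beta> \<le> \<alpha>\<close> by simp
    qed (use \<open>\<alpha> > 0\<close> in simp)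
    finally show ?thesis by (simp add: mult.commute)
  qed
  show ?thesis
  proof (rule pendant_boundI[OF x, of A B u u w k d S "N - {s}"])
    have sN: "sum x (N - {s}) = \<nu> - x s" using fins s by (simp add: sum_diff1 \<nu>_def)
    show "x w * (sum x V - x u - x w - sum x S) + x u * (sum x V - x u - x w - sum x (N - {s}))
      < sum x A * sum x B + x u * (sum x V - x u - sum x (?E `` {u}))"
      using main unfolding sV sN Nu \<beta>_def by (simp add: algebra_simps flip: a_def b_def \<sigma>_def \<nu>_def)
    show "card (N - {s}) \<le> d" using card s by (simp add: card_Diff_singleton)
    show "?E \<inter> A \<times> B = {}" by (auto simp: isolated_rel_def)
    show "S \<subseteq> V - {u, w}" using V(7) part(2,6) w by blast
    then show "N - {s} \<subseteq> V - {u, w}" using N by blast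
    show "u \<noteq> w" using part(4) w by blast
  qed (use V part(3,4,7) card in simp_all)
qed

lemma pendant_bound_isolated:
  assumes g: "graph_rel V (isolated_rel V u N A B)"
    and part: "V = S \<union> {u} \<union> A \<union> B" "u \<notin> S" "u \<notin> A" "u \<notin> B" "S \<inter> A = {}" "S \<inter> B = {}" "A \<inter> B = {}"
    and N: "N \<subseteq> S" and card: "card S = k" "card N = Suc d" "d \<le> k" "k + 2 \<le> card V"
    and AB: "2 \<le> card A" "2 \<le> card B"
  shows "pendant_bound V (isolated_rel V u N A B) k d"
proof (cases "card B \<le> card A")
  case True
  then show ?thesis by (intro pendant_bound_isolated_aux[OF g part N card] AB)
next
  case False
  then show ?thesis
    unfolding isolated_rel_swap[of V u N A B] using part AB
    by (intro pendant_bound_isolated_aux[of V u N B A S] N card g[unfolded isolated_rel_swap[of V u N A B]]) auto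
qed

lemma two_le_card_of_edge:
  assumes "finite A" "irrefl E" "E \<inter> A \<times> A \<noteq> {}"
  shows "2 \<le> card A"
proof -
  obtain p q where "(p, q) \<in> E" "p \<in> A" "q \<in> A" using assms(3) by blast
  then have "{p, q} \<subseteq> A" "p \<noteq> q" using assms(2) by (auto simp: irrefl_def)
  then show ?thesis using card_mono[OF assms(1), of "{p, q}"] by simp
qed

text \<open>If \<open>u\<close> has no neighbour in \<open>A\<close>, all its neighbours lie in
  \<open>S\<close>. The graph then embeds in an \<open>isolated_rel\<close> with the same
  neighbourhood of \<open>u\<close>, and \<open>A - {u}\<close> still contains an edge.\<close>

lemma (in split_graph) pendant_bound_outside_cut:
  assumes edges: "E \<inter> A \<times> A \<noteq> {}" "E \<inter> B \<times> B \<noteq> {}" and u: "u \<in> A"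
    and card: "card S = k" "card (E `` {u}) = Suc d" "d \<le> k" "k + 2 \<le> card V"
  shows "pendant_bound V E k d"
proof (cases "\<exists>v\<in>A. (u, v) \<in> E")
  case True
  then obtain v where v: "(u, v) \<in> E" "v \<in> A" by blast
  show ?thesis
    by (rule pendant_bound_in_component[OF u card v two_le_card_of_edge[OF fins(3) irr edges(2)]])
next
  case False
  let ?A = "A - {u}" and ?N = "E `` {u}"
  let ?F = "isolated_rel V u ?N ?A B"
  have N: "?N \<subseteq> S"
  proof
    fix q assume "q \<in> ?N"
    then have "q \<in> V" "q \<notin> A" "q \<notin> B" using False EV noedge u by auto
    then show "q \<in> S" using AB(1) by blast
  qed
  have EF: "E \<subseteq> ?F"
  proof clarify
    fix p q assume "(p, q) \<in> E"
    moreover from this have "(q, p) \<in> E" "p \<noteq> q" "p \<in> V" "q \<in> V"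
      using sym irr EV by (auto simp: irrefl_def dest: symD)
    ultimately show "(p, q) \<in> ?F" using noedge unfolding isolated_rel_def by blast
  qed
  have g: "graph_rel V ?F"
  proof
    show "sym ?F" by (auto simp: sym_def isolated_rel_def)
    show "connected_rel V ?F" by (rule connected_rel_mono[OF conn EF])
  qed (use fin ne in \<open>auto simp: isolated_rel_def irrefl_def\<close>)
  have "E \<inter> ?A \<times> ?A \<noteq> {}"
  proof -
    obtain p q where pq: "(p, q) \<in> E" "p \<in> A" "q \<in> A" using edges(1) by blast
    then have "(q, p) \<in> E" using sym by (auto dest: symD)
    then have "p \<noteq> u" "q \<noteq> u" using pq False by auto
    then show ?thesis using pq by blast
  qed
  then have A2: "2 \<le> card ?A" using fins by (intro two_le_card_of_edge[OF _ irr]) auto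
  have part: "V = S \<union> {u} \<union> ?A \<union> B" "u \<notin> S" "u \<notin> ?A" "u \<notin> B" "S \<inter> ?A = {}" "S \<inter> B = {}" "?A \<inter> B = {}"
    using SV AB u by blast+
  have "pendant_bound V ?F k d"
    by (rule pendant_bound_isolated[OF g part N card A2 two_le_card_of_edge[OF fins(3) irr edges(2)]])
  then show ?thesis by (rule pendant_bound_mono[OF graph_rel_axioms g EF])
qed

lemma (in split_graph) pendant_bound:
  assumes edges: "E \<inter> A \<times> A \<noteq> {}" "E \<inter> B \<times> B \<noteq> {}" and u: "u \<in> V"
    and card: "card S = k" "card (E `` {u}) = Suc d" "d < k" "k + 2 \<le> card V"
    and cut: "u \<in> S \<Longrightarrow> E `` {u} \<inter> A \<noteq> {} \<and> E `` {u} \<inter> B \<noteq> {}"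
  shows "pendant_bound V E k d"
proof -
  interpret s: split_graph V E S B A by (rule swap)
  consider "u \<in> S" | "u \<in> A" | "u \<in> B" using u AB by blast
  then show ?thesis
  proof cases
    case 1
    then obtain v w where vw: "(u, v) \<in> E" "v \<in> A" "(u, w) \<in> E" "w \<in> B" using cut by blast
    show ?thesis by (rule pendant_bound_in_cut[OF 1 card vw])
  next
    case 2
    show ?thesis by (rule pendant_bound_outside_cut[OF edges 2 card(1,2) less_imp_le[OF card(3)] card(4)])
  next
    case 3
    show ?thesis
      by (rule s.pendant_bound_outside_cut[OF edges(2,1) 3 card(1,2) less_imp_le[OF card(3)] card(4)])
  qed
qed

section \<open>Minimum degree larger than the essential connectivity\<close>

definition two_clique_bound :: "'a set \<Rightarrow> 'a rel \<Rightarrow> nat \<Rightarrow> nat \<Rightarrow> bool" where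
  "two_clique_bound V E a b \<longleftrightarrow> (\<exists>A B. A \<subseteq> V \<and> B \<subseteq> V \<and> A \<inter> B = {} \<and> card A = a \<and> card B = b \<and>
     (E \<subseteq> two_clique_rel V A B \<or>
      graph_spectral_radius (mk_graph V E) < graph_spectral_radius (mk_graph V (two_clique_rel V A B))))"

context split_graph
begin

lemma subset_two_clique_rel: "E \<subseteq> two_clique_rel V A B"
proof clarify
  fix p q assume "(p, q) \<in> E"
  moreover from this have "(q, p) \<in> E" "p \<noteq> q" "p \<in> V" "q \<in> V"
    using sym irr EV by (auto simp: irrefl_def dest: symD)
  ultimately show "(p, q) \<in> two_clique_rel V A B" using noedge unfolding two_clique_rel_def by blast
qed

lemma min_degree_le_card_component:
  assumes "\<And>v. v \<in> V \<Longrightarrow> \<delta> \<le> card (E `` {v})" "A \<noteq> {}"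
  shows "\<delta> + 1 \<le> card A + card S"
proof -
  obtain p where p: "p \<in> A" using assms(2) by blast
  have "E `` {p} \<subseteq> (A - {p}) \<union> S"
  proof
    fix q assume "q \<in> E `` {p}"
    then have "q \<in> V" "q \<noteq> p" "q \<notin> B" using EV irr noedge p by (auto simp: irrefl_def)
    then show "q \<in> (A - {p}) \<union> S" using AB by blast
  qed
  then have "card (E `` {p}) \<le> card ((A - {p}) \<union> S)" using fins by (intro card_mono) auto
  also have "\<dots> \<le> card (A - {p}) + card S" by (rule card_Un_le)
  finally have "card (E `` {p}) \<le> card (A - {p}) + card S" .
  moreover have "card A = Suc (card (A - {p}))" using card.remove[OF fins(2) p] .
  moreover have "\<delta> \<le> card (E `` {p})" using assms(1) p subV by blast
  ultimately show ?thesis by linarith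
qed

text \<open>Moving vertices from the lighter side to the heavier one lowers the product of the two
  weights, which is the weight of the missing pairs. The kept set \<open>M\<close> is an arbitrary
  subset of \<open>A\<close> of size \<open>m\<close>.\<close>

lemma two_clique_bound_aux:
  assumes x: "perron_vec x" and le: "sum x A \<le> sum x B" and m: "m \<le> card A" "0 < m"
  shows "two_clique_bound V E (card V - card S - m) m"
proof -
  have cV: "card V = card S + card A + card B"
  proof -
    have "V = S \<union> (A \<union> B)" "S \<inter> (A \<union> B) = {}" using SV AB by auto
    then show ?thesis using fins AB(2) by (simp add: card_Un_disjoint)
  qed
  obtain M where M: "M \<subseteq> A" "card M = m" "finite M" using obtain_subset_with_card_n[OF m(1)] by blast
  define B' where "B' = B \<union> (A - M)"
  have B': "B' \<subseteq> V" "M \<subseteq> V" "B' \<inter> M = {}" using M subV AB by (auto simp: B'_def)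
  have "card B' = card B + card (A - M)"
    unfolding B'_def using fins AB by (intro card_Un_disjoint) auto
  then have cB': "card B' = card V - card S - m"
    using M m cV fins by (simp add: card_Diff_subset)
  have "E \<subseteq> two_clique_rel V B' M \<or>
    graph_spectral_radius (mk_graph V E) < graph_spectral_radius (mk_graph V (two_clique_rel V B' M))"
  proof (cases "M = A")
    case True
    then have "two_clique_rel V B' M = two_clique_rel V A B" by (auto simp: B'_def two_clique_rel_def)
    then show ?thesis using subset_two_clique_rel by simp
  next
    case False
    define t r where "t = sum x M" and "r = sum x (A - M)"
    have "r > 0" unfolding r_def
      using False M fins subV perron_vec_pos[OF x] by (intro sum_pos) auto
    have sA: "sum x A = t + r" unfolding t_def r_def using M fins by (simp add: sum_diff)
    have sB': "sum x B' = sum x B + r"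
      unfolding B'_def r_def using fins AB by (intro sum.union_disjoint) auto
    \<comment> \<open>Strict because \<open>t < t + r \<le> sum x B\<close>.\<close>
    have "t * (sum x B + r) < (t + r) * sum x B"
    proof -
      have "r * t < r * sum x B" using le sA \<open>r > 0\<close> by (intro mult_strict_left_mono) auto
      then show ?thesis by (simp add: algebra_simps)
    qed
    then have "quad (two_clique_rel V A B) x < quad (two_clique_rel V B' M) x"
      unfolding quad_two_clique_rel[OF fin subV AB(2)] quad_two_clique_rel[OF fin B'] sB' sA t_def[symmetric]
      by (simp add: mult.commute)
    moreover have "quad E x \<le> quad (two_clique_rel V A B) x"
      unfolding quad_def case_prod_beta
    proof (rule sum_mono2)
      show "finite (two_clique_rel V A B)" by (rule finite_rel[OF fin two_clique_rel_simps(1)])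
      fix e assume "e \<in> two_clique_rel V A B - E"
      then have "fst e \<in> V" "snd e \<in> V" by (auto simp: two_clique_rel_def)
      then show "0 \<le> x (fst e) * x (snd e)" using perron_vec_pos[OF x] by (simp add: less_imp_le)
    qed (rule subset_two_clique_rel)
    ultimately have "quad E x < quad (two_clique_rel V B' M) x" by simp
    then show ?thesis
      using x unfolding perron_vec_def
      by (intro disjI2 spectral_radius_less[OF fin ne two_clique_rel_simps, of E x]) simp_all
  qed
  then show ?thesis using B' cB' M(2) unfolding two_clique_bound_def by blast
qed

end

lemma (in split_graph) two_clique_bound:
  assumes deg: "\<And>v. v \<in> V \<Longrightarrow> \<delta> \<le> card (E `` {v})" and AB0: "A \<noteq> {}" "B \<noteq> {}" and S: "card S < \<delta>"
  shows "two_clique_bound V E (card V - \<delta> - 1) (\<delta> - card S + 1)"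
proof -
  interpret s: split_graph V E S B A by (rule swap)
  obtain x where x: "perron_vec x" by (rule perron)
  let ?m = "\<delta> - card S + 1"
  have m: "?m \<le> card A" "?m \<le> card B" "0 < ?m"
    using min_degree_le_card_component[OF deg AB0(1)] s.min_degree_le_card_component[OF deg AB0(2)] S
    by linarith+
  have e: "card V - \<delta> - 1 = card V - card S - ?m" using S by linarith
  show ?thesis unfolding e
  proof (cases "sum x A \<le> sum x B")
    case True
    then show "two_clique_bound V E (card V - card S - ?m) ?m" by (intro two_clique_bound_aux[OF x _ m(1,3)])
  next
    case False
    then show "two_clique_bound V E (card V - card S - ?m) ?m" by (intro s.two_clique_bound_aux[OF x _ m(2,3)]) simp
  qed
qed

section \<open>Equality case and conclusion\<close>

text \<open>Either \<open>E = F\<close> and \<open>\<sigma>\<close> is the isomorphism, or the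
  radius is strictly smaller, which rules out any isomorphism since isomorphic graphs have equal
  radii.\<close>

lemma (in graph_rel) spectral_radius_extremal:
  assumes F: "F \<subseteq> V \<times> V" "sym F" and H: "H \<subseteq> W \<times> W" and iso: "rel_iso \<sigma> V F W H"
    and bound: "E \<subseteq> F \<or> graph_spectral_radius (mk_graph V E) < graph_spectral_radius (mk_graph V F)"
  shows "graph_spectral_radius (mk_graph V E) \<le> graph_spectral_radius (mk_graph W H) \<and>
    (graph_spectral_radius (mk_graph V E) = graph_spectral_radius (mk_graph W H) \<longleftrightarrow>
      digraph_iso (with_proj (mk_graph V E)) (with_proj (mk_graph W H)))"
proof -
  have FH: "graph_spectral_radius (mk_graph V F) = graph_spectral_radius (mk_graph W H)"
    by (rule rel_iso_spectral_radius[OF fin F(1) H iso])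
  show ?thesis
  proof (cases "E = F")
    case True
    then show ?thesis using FH iso digraph_iso_mk_graph[OF EV H] by auto
  next
    case False
    then have less: "graph_spectral_radius (mk_graph V E) < graph_spectral_radius (mk_graph W H)"
      using bound spectral_radius_strict_mono[OF fin ne sym conn F] FH by auto
    moreover have "\<not> digraph_iso (with_proj (mk_graph V E)) (with_proj (mk_graph W H))"
      using less rel_iso_spectral_radius[OF fin EV H] digraph_iso_mk_graph[OF EV H] by auto
    ultimately show ?thesis by simp
  qed
qed

text \<open>If \<open>u\<close> had no neighbour in \<open>B\<close>, moving it to \<open>A\<close>
  would leave a smaller essential cut. Exchanging the sides gives the same for
  \<open>A\<close>.\<close>

lemma minimum_cut_vertex_meets_both_sides:
  assumes G: "pair_graph G" and sp: "splits (pverts G) (parcs G) S A B"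
    and min: "card S = essential_connectivity G" and u: "u \<in> S"
  shows "parcs G `` {u} \<inter> B \<noteq> {}"
proof
  assume empty: "parcs G `` {u} \<inter> B = {}"
  have "splits (pverts G) (parcs G) (S - {u}) (insert u A) B"
    using sp empty u unfolding splits_def by blast
  then have "essential_connectivity G \<le> card (S - {u})"
    by (intro essential_connectivity_le[OF G] splits_imp_essential_vertex_cut[OF G])
  moreover have "finite S"
    using sp pair_graph_rel(1)[OF G] finite_subset unfolding splits_def by blast
  ultimately show False using min card_Diff1_less[of S u] u by simp
qed

theorem theorem1:
  fixes G :: "'a pair_pre_digraph" and n \<delta> \<kappa> :: nat
  assumes "pair_graph G"
    and "connected (with_proj G)"
    and "card (pverts G) = n"
    and "min_degree G = \<delta>"
    and "\<exists>S. essential_vertex_cut G S"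
    and "essential_connectivity G = \<kappa>"
    and "n \<ge> \<kappa> + 4"
  shows "graph_spectral_radius G \<le> graph_spectral_radius (extremal_graph n \<kappa> \<delta>) \<and>
    (graph_spectral_radius G = graph_spectral_radius (extremal_graph n \<kappa> \<delta>) \<longleftrightarrow>
      digraph_iso (with_proj G) (with_proj (extremal_graph n \<kappa> \<delta>)))"
proof -
  let ?V = "pverts G" and ?E = "parcs G"
  note G = assms(1)
  note connG = connected_imp_connected_rel[OF assms(1,2)]
  interpret graph_rel ?V ?E
    using pair_graph_rel[OF G] connG by unfold_locales
  obtain S where S: "essential_vertex_cut G S" "card S = \<kappa>"
    using essential_connectivity_attained[OF G assms(5)] assms(6) by blast
  obtain A B where sp: "splits ?V ?E S A B" by (rule essential_vertex_cut_imp_splits[OF G S(1)])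
  then have sp': "splits ?V ?E S B A"
    using sym unfolding splits_def by (auto dest: symD)
  interpret split_graph ?V ?E S A B
    using sp unfolding splits_def by unfold_locales auto
  have edges: "?E \<inter> A \<times> A \<noteq> {}" "?E \<inter> B \<times> B \<noteq> {}" using sp by (auto simp: splits_def)
  obtain u where u: "u \<in> ?V" "card (?E `` {u}) = \<delta>"
    using min_degree_attained(2)[OF G ne] assms(4) by blast
  have deg: "\<delta> \<le> card (?E `` {v})" if "v \<in> ?V" for v
    using min_degree_attained(1)[OF G ne that] assms(4) by simp
  \<comment> \<open>A vertex of degree 0 would be closed under neighbours on its own and hence the
    whole graph, which has at least 4 vertices.\<close>
  have "\<delta> \<noteq> 0"
  proof
    assume "\<delta> = 0"
    then have "?E `` {u} \<subseteq> {u}" using u finN by simp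
    then have "?V = {u}" using connG(2) u(1) unfolding connected_rel_def by blast
    then show False using assms(3,7) by simp
  qed
  then obtain d where d: "\<delta> = Suc d" by (cases \<delta>) auto
  show ?thesis
  proof (cases "\<delta> \<le> \<kappa>")
    case True
    have "pendant_bound ?V ?E \<kappa> d"
      using minimum_cut_vertex_meets_both_sides[OF G sp] minimum_cut_vertex_meets_both_sides[OF G sp']
      by (intro pendant_bound[OF edges u(1)]) (use S(2) u(2) d True assms in simp_all)
    then obtain u' v T N where c: "pendant_config ?V u' v T N" "card T = \<kappa>" "card N = d"
      and bound: "?E \<subseteq> pendant_rel ?V u' v T N \<or> graph_spectral_radius (mk_graph ?V ?E)
        < graph_spectral_radius (mk_graph ?V (pendant_rel ?V u' v T N))"
      unfolding pendant_bound_def by blast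
    have "pendant_config {0..<n} (n - 1) \<kappa> {0..<\<kappa>} {0..<\<delta> - 1}"
      using True assms(7) d by unfold_locales auto
    then obtain \<sigma> where \<sigma>: "rel_iso \<sigma> ?V (pendant_rel ?V u' v T N) {0..<n}
        (pendant_rel {0..<n} (n - 1) \<kappa> {0..<\<kappa>} {0..<\<delta> - 1})"
      by (rule pendant_rel_iso[OF c(1)]) (use c assms(3) d in auto)
    have eq: "extremal_graph n \<kappa> \<delta> = mk_graph {0..<n} (pendant_rel {0..<n} (n - 1) \<kappa> {0..<\<kappa>} {0..<\<delta> - 1})"
      using True assms(7) d by (intro extremal_graph_eq_pendant) auto
    show ?thesis
      using spectral_radius_extremal[OF pendant_rel_simps pendant_rel_simps(1) \<sigma> bound]
      unfolding eq mk_graph_collapse .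
  next
    case False
    have "A \<noteq> {}" "B \<noteq> {}" using edges by auto
    then have "two_clique_bound ?V ?E (n - \<delta> - 1) (\<delta> - \<kappa> + 1)"
      using two_clique_bound[OF deg] S(2) False assms(3) by simp
    then obtain C D where c: "C \<subseteq> ?V" "D \<subseteq> ?V" "C \<inter> D = {}" "card C = n - \<delta> - 1" "card D = \<delta> - \<kappa> + 1"
      and bound: "?E \<subseteq> two_clique_rel ?V C D \<or> graph_spectral_radius (mk_graph ?V ?E)
        < graph_spectral_radius (mk_graph ?V (two_clique_rel ?V C D))"
      unfolding two_clique_bound_def by blast
    \<comment> \<open>Since \<open>u\<close> is not its own neighbour, \<delta> < n, which makes the
      truncated subtraction \<open>n - \<delta> - 1\<close> exact.\<close>
    have "?E `` {u} \<subseteq> ?V - {u}" using EV irr by (auto simp: irrefl_def)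
    then have n: "\<delta> + 1 \<le> n"
      using card_mono[of "?V - {u}" "?E `` {u}"] u fin assms(3,7) by (simp add: card_Diff_singleton)
    let ?C = "{\<kappa>..<\<kappa> + (n - \<delta> - 1)}" and ?D = "{\<kappa> + (n - \<delta> - 1)..<n}"
    have sub: "?C \<subseteq> {0..<n}" "?D \<subseteq> {0..<n}" "?C \<inter> ?D = {}" "card ?C = card C" "card ?D = card D"
      using c False n by auto
    obtain \<sigma> where \<sigma>: "rel_iso \<sigma> ?V (two_clique_rel ?V C D) {0..<n} (two_clique_rel {0..<n} ?C ?D)"
      by (rule two_clique_rel_iso[OF fin _ c(1) sub(1) c(2) sub(2) c(3) sub(3) _ sub(4,5)])
        (use assms(3) in auto)
    have eq: "extremal_graph n \<kappa> \<delta> = mk_graph {0..<n} (two_clique_rel {0..<n} ?C ?D)"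
      using False n by (intro extremal_graph_eq_two_clique) auto
    show ?thesis
      using spectral_radius_extremal[OF two_clique_rel_simps two_clique_rel_simps(1) \<sigma> bound]
      unfolding eq mk_graph_collapse .
  qed
qed

end
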